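(* Let $(E,\rho,[\cdot,\cdot]_E,L)$ be a local almost-Leibniz algebroid, let $g$ be an $E$-metric and let $\nabla$ be an admissible linear $E$-connection. Then for all $u,v,w\in\mathfrak{X}(E)$, $$2g(\nabla_uv,w)=2g({}^g\tilde\nabla_uv,w)-Q(\nabla,g)(u,v,w)-Q(\nabla,g)(v,u,w)+Q(\nabla,g)(w,u,v)-g(T(\nabla)(v,w),u)-g(T(\nabla)(u,w),v)+g(T(\nabla)(u,v),w),$$ where ${}^g\tilde\nabla$ is the unique $E$-Levi-Civita connection (with respect to $g$) on the almost-Lie algebroid $(E,\rho,[\cdot,\cdot]_E^\nabla)$.
   Context: Everything is smooth. $M$ is a manifold, $E\to M$ a real vector bundle of constant rank, $\mathfrak{X}(E)=\Gamma(E)$, $\Omega^1(E)=\Gamma(E^* )$. An anchored vector bundle $(E,\rho)$ has a vector bundle morphism $\rho:E\to T(M)$ over the identity. An almost-Leibniz algebroid $(E,\rho,[\cdot,\cdot]_E)$ is an anchored vector bundle with an $\mathbb{R}$-bilinear bracket on $\mathfrak{X}(E)$ satisfying $[u,fv]_E=\rho(u)(f)v+f[u,v]_E$; it is almost-Lie if the bracket is anti-symmetric. It is local with locality operator $L$, a $C^\infty(M,\mathbb{R})$-multilinear map $L:\Omega^1(E)\times\mathfrak{X}(E)\times\mathfrak{X}(E)\to\mathfrak{X}(E)$, if $[fu,v]_E=-\rho(v)(f)u+f[u,v]_E+L(Df,u,v)$, where $(Df)(u):=\rho(u)(f)$. An $E$-metric is a non-degenerate symmetric fiberwise bilinear form on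 $E$. A linear $E$-connection is an $\mathbb{R}$-bilinear map $\nabla:\mathfrak{X}(E)\times\mathfrak{X}(E)\to\mathfrak{X}(E)$ with $\nabla_u(fv)=\rho(u)(f)v+f\nabla_uv$ and $\nabla_{fu}v=f\nabla_uv$. $(X_a)$ denotes a local frame of $E$, $(e^a)$ the dual coframe, repeated indices are summed; $L(e^a,\nabla_{X_a}u,v)$ does not depend on the frame. $\nabla$ is admissible if $[u,v]_E+[v,u]_E=L(e^a,\nabla_{X_a}u,v)+L(e^a,\nabla_{X_a}v,u)$ for all $u,v$. Modified bracket: $[u,v]_E^\nabla:=[u,v]_E-L(e^a,\nabla_{X_a}u,v)$; for admissible $\nabla$, $(E,\rho,[\cdot,\cdot]_E^\nabla)$ is an almost-Lie algebroid. $E$-torsion: $T(\nabla)(u,v):=\nabla_uv-\nabla_vu-[u,v]_E^\nabla$. $E$-non-metricity: $Q(\nabla,g)(u,v,w):=\rho(u)(g(v,w))-g(\nabla_uv,w)-g(v,\nabla_uw)$. On an almost-Lie algebroid $(E,\rho,[\cdot,\cdot])$ (taken with zero locality operator), the $E$-Levi-Civita connection of $g$ is the unique linear $E$-connection $\tilde\nabla$ with $\tilde\nabla_uv-\tilde\nabla_vu=[u,v]$ and $Q(\tilde\nabla,g)=0$; it is given by the Koszul formula. *)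

theory Defs
  imports "HOL-Analysis.Analysis" "HOL-Library.Function_Algebras"
begin

text \<open>
  Real vector space structure on functions, pointwise. It is used for sections, and for the
  fibres of the tangent and dual bundles, whose elements are functionals.
\<close>

instantiation "fun" :: (type, real_vector) real_vector
begin

definition scaleR_fun :: "real \<Rightarrow> ('a \<Rightarrow> 'b) \<Rightarrow> 'a \<Rightarrow> 'b" where
  "scaleR_fun c f = (\<lambda>x. c *\<^sub>R f x)"

instance
  by standard (auto simp: scaleR_fun_def fun_eq_iff scaleR_add_right scaleR_add_left)

end


section \<open>Smooth manifolds\<close>

text \<open>
  Smoothness of maps between finite-dimensional spaces, meant for open \<open>S\<close>. All directional
  derivatives being \<open>C^k\<close> is the same as the total derivative being \<open>C^k\<close>.
\<close>

primrec Ck_on :: "nat \<Rightarrow> 'a::real_normed_vector set \<Rightarrow> ('a \<Rightarrow> 'b::real_normed_vector) \<Rightarrow> bool" where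
  "Ck_on 0 S f \<longleftrightarrow> continuous_on S f"
| "Ck_on (Suc k) S f \<longleftrightarrow> (\<forall>x\<in>S. f differentiable (at x)) \<and>
     (\<forall>v. Ck_on k S (\<lambda>x. frechet_derivative f (at x) v))"

definition smooth_on :: "'a::real_normed_vector set \<Rightarrow> ('a \<Rightarrow> 'b::real_normed_vector) \<Rightarrow> bool" where
  "smooth_on S f \<longleftrightarrow> (\<forall>k. Ck_on k S f)"

text \<open>
  A chart is a domain together with its coordinate map. The manifold is the whole type \<open>'m\<close>.
  The model space \<open>'n\<close> is a finite-dimensional inner product space; the class
  \<open>euclidean_space\<close> is avoided only because it excludes dimension 0.
\<close>

type_synonym ('m, 'n) chart = "'m set \<times> ('m \<Rightarrow> 'n)"

definition smooth_atlas ::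
  "('m::{t2_space,second_countable_topology}, 'n::real_inner) chart set \<Rightarrow> bool" where
  "smooth_atlas A \<longleftrightarrow>
     (\<exists>B::'n set. finite B \<and> span B = UNIV) \<and>
     (\<Union>(U, \<phi>)\<in>A. U) = UNIV \<and>
     (\<forall>(U, \<phi>)\<in>A. open U \<and> open (\<phi> ` U) \<and> homeomorphism U (\<phi> ` U) \<phi> (inv_into U \<phi>)) \<and>
     (\<forall>(U, \<phi>)\<in>A. \<forall>(V, \<psi>)\<in>A. smooth_on (\<phi> ` (U \<inter> V)) (\<psi> \<circ> inv_into U \<phi>))"

definition smooth_fun ::
  "('m, 'n::real_inner) chart set \<Rightarrow> 'm set \<Rightarrow> ('m \<Rightarrow> real) \<Rightarrow> bool" where
  "smooth_fun A W f \<longleftrightarrow> (\<forall>(U, \<phi>)\<in>A. smooth_on (\<phi> ` (U \<inter> W)) (f \<circ> inv_into U \<phi>))"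

definition Cinf :: "('m, 'n::real_inner) chart set \<Rightarrow> ('m \<Rightarrow> real) set" where
  "Cinf A = {f. smooth_fun A UNIV f}"


section \<open>Vector bundles\<close>

text \<open>
  The fibres are subspaces of one vector space \<open>'f\<close>, with no relation assumed between different
  fibres (for an arbitrary bundle one can take the direct sum of all fibres as \<open>'f\<close>). The smooth
  structure is given by local trivializations. A trivialization over \<open>U\<close> is written as the local
  frame \<open>(X i)\<close>, \<open>i < rank E\<close>, that is the image of the standard frame of \<open>U \<times> \<real>^rank\<close>.
\<close>

record ('m, 'f) vbundle =
  fibre :: "'m \<Rightarrow> 'f set"
  rank :: nat
  frames :: "('m set \<times> (nat \<Rightarrow> 'm \<Rightarrow> 'f)) set"

definition is_basis :: "'f::real_vector set \<Rightarrow> nat \<Rightarrow> (nat \<Rightarrow> 'f) \<Rightarrow> bool" where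
  "is_basis V k b \<longleftrightarrow> inj_on b {..<k} \<and> independent (b ` {..<k}) \<and> span (b ` {..<k}) = V"

definition smooth_section_on ::
  "('m, 'n::real_inner) chart set \<Rightarrow> ('m, 'f::real_vector) vbundle \<Rightarrow> 'm set \<Rightarrow> ('m \<Rightarrow> 'f) \<Rightarrow> bool"
where
  "smooth_section_on A E W s \<longleftrightarrow>
     (\<forall>p\<in>W. s p \<in> fibre E p) \<and>
     (\<forall>(U, X)\<in>frames E. \<exists>c. (\<forall>i<rank E. smooth_fun A (U \<inter> W) (c i)) \<and>
        (\<forall>p\<in>U \<inter> W. s p = (\<Sum>i<rank E. c i p *\<^sub>R X i p)))"

definition sections ::
  "('m, 'n::real_inner) chart set \<Rightarrow> ('m, 'f::real_vector) vbundle \<Rightarrow> ('m \<Rightarrow> 'f) set" where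
  "sections A E = {s. smooth_section_on A E UNIV s}"

text \<open>The last condition says that the transition functions are smooth.\<close>

definition vector_bundle ::
  "('m::topological_space, 'n::real_inner) chart set \<Rightarrow> ('m, 'f::real_vector) vbundle \<Rightarrow> bool" where
  "vector_bundle A E \<longleftrightarrow>
     (\<forall>p. subspace (fibre E p)) \<and>
     (\<Union>(U, X)\<in>frames E. U) = UNIV \<and>
     (\<forall>(U, X)\<in>frames E. open U \<and> (\<forall>p\<in>U. is_basis (fibre E p) (rank E) (\<lambda>i. X i p))) \<and>
     (\<forall>(U, X)\<in>frames E. \<forall>i<rank E. smooth_section_on A E U (X i))"

text \<open>
  The functional \<open>coframe k X i p\<close> returns the \<open>i\<close>-th coordinate with respect to the basis
  \<open>X 0 p, \<dots>, X (k - 1) p\<close> of the fibre, and vanishes outside the fibre. Elements of the dual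
  fibre are likewise normalised to vanish outside the fibre.
\<close>

definition coframe :: "nat \<Rightarrow> (nat \<Rightarrow> 'm \<Rightarrow> 'f::real_vector) \<Rightarrow> nat \<Rightarrow> 'm \<Rightarrow> 'f \<Rightarrow> real" where
  "coframe k X i p = (\<lambda>v. representation ((\<lambda>j. X j p) ` {..<k}) v (X i p))"

definition linear_on_set :: "'a::real_vector set \<Rightarrow> ('a \<Rightarrow> 'b::real_vector) \<Rightarrow> bool" where
  "linear_on_set V h \<longleftrightarrow>
     (\<forall>v\<in>V. \<forall>w\<in>V. h (v + w) = h v + h w) \<and> (\<forall>c. \<forall>v\<in>V. h (c *\<^sub>R v) = c *\<^sub>R h v)"

definition dual_bundle :: "('m, 'f::real_vector) vbundle \<Rightarrow> ('m, 'f \<Rightarrow> real) vbundle" where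
  "dual_bundle E = \<lparr>
     fibre = (\<lambda>p. {\<alpha>. linear_on_set (fibre E p) \<alpha> \<and> (\<forall>v. v \<notin> fibre E p \<longrightarrow> \<alpha> v = 0)}),
     rank = rank E,
     frames = {(U, coframe (rank E) X) |U X. (U, X) \<in> frames E}\<rparr>"

text \<open>
  Tangent vectors at \<open>p\<close> are the derivations of \<open>Cinf A\<close> at \<open>p\<close>, normalised to vanish on
  non-smooth functions. The trivializations of the tangent bundle are the coordinate frames of the
  charts; \<open>'n\<close> has no preferred basis, so all bases are used.
\<close>

definition tangent_space :: "('m, 'n::real_inner) chart set \<Rightarrow> 'm \<Rightarrow> (('m \<Rightarrow> real) \<Rightarrow> real) set" where
  "tangent_space A p = {\<xi>.
     linear_on_set (Cinf A) \<xi> \<and>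
     (\<forall>f\<in>Cinf A. \<forall>h\<in>Cinf A. \<xi> (f * h) = \<xi> f * h p + f p * \<xi> h) \<and>
     (\<forall>f. f \<notin> Cinf A \<longrightarrow> \<xi> f = 0)}"

definition coordinate_vector ::
  "('m, 'n::real_inner) chart set \<Rightarrow> ('m, 'n) chart \<Rightarrow> 'n \<Rightarrow> 'm \<Rightarrow> ('m \<Rightarrow> real) \<Rightarrow> real" where
  "coordinate_vector A = (\<lambda>(U, \<phi>) b p f.
     if f \<in> Cinf A then frechet_derivative (f \<circ> inv_into U \<phi>) (at (\<phi> p)) b else 0)"

definition tangent_bundle ::
  "('m, 'n::real_inner) chart set \<Rightarrow> ('m, ('m \<Rightarrow> real) \<Rightarrow> real) vbundle" where
  "tangent_bundle A = \<lparr>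
     fibre = tangent_space A,
     rank = dim (UNIV :: 'n set),
     frames = {(U, \<lambda>i. coordinate_vector A (U, \<phi>) (b i)) |U \<phi> b.
       (U, \<phi>) \<in> A \<and> is_basis UNIV (dim (UNIV :: 'n set)) b}\<rparr>"

definition vb_morphism ::
  "('m, 'n::real_inner) chart set \<Rightarrow> ('m, 'f::real_vector) vbundle \<Rightarrow>
   ('m, 'h::real_vector) vbundle \<Rightarrow> ('m \<Rightarrow> 'f \<Rightarrow> 'h) \<Rightarrow> bool" where
  "vb_morphism A E F \<rho> \<longleftrightarrow>
     (\<forall>p. \<rho> p \<in> fibre E p \<rightarrow> fibre F p \<and> linear_on_set (fibre E p) (\<rho> p)) \<and>
     (\<forall>(U, X)\<in>frames E. \<forall>i<rank E. smooth_section_on A F U (\<lambda>p. \<rho> p (X i p)))"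

definition E_metric ::
  "('m, 'n::real_inner) chart set \<Rightarrow> ('m, 'f::real_vector) vbundle \<Rightarrow>
   ('m \<Rightarrow> 'f \<Rightarrow> 'f \<Rightarrow> real) \<Rightarrow> bool" where
  "E_metric A E g \<longleftrightarrow>
     (\<forall>p. \<forall>v\<in>fibre E p. linear_on_set (fibre E p) (g p v)) \<and>
     (\<forall>p. \<forall>v\<in>fibre E p. \<forall>w\<in>fibre E p. g p v w = g p w v) \<and>
     (\<forall>p. \<forall>v\<in>fibre E p. (\<forall>w\<in>fibre E p. g p v w = 0) \<longrightarrow> v = 0) \<and>
     (\<forall>(U, X)\<in>frames E. \<forall>i<rank E. \<forall>j<rank E. smooth_fun A U (\<lambda>p. g p (X i p) (X j p)))"


section \<open>Algebroids\<close>

type_synonym ('m, 'f) sec = "'m \<Rightarrow> 'f"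
type_synonym ('m, 'f) anchor = "'m \<Rightarrow> 'f \<Rightarrow> ('m \<Rightarrow> real) \<Rightarrow> real"
type_synonym ('m, 'f) secop = "('m, 'f) sec \<Rightarrow> ('m, 'f) sec \<Rightarrow> ('m, 'f) sec"
type_synonym ('m, 'f) locop = "('m, 'f \<Rightarrow> real) sec \<Rightarrow> ('m, 'f) secop"

definition fmult :: "('m \<Rightarrow> real) \<Rightarrow> ('m \<Rightarrow> 'f::real_vector) \<Rightarrow> 'm \<Rightarrow> 'f"  (infixr "*\<^sub>F" 75) where
  "f *\<^sub>F s = (\<lambda>p. f p *\<^sub>R s p)"

definition real_bilinear_on :: "'a::real_vector set \<Rightarrow> ('a \<Rightarrow> 'a \<Rightarrow> 'a) \<Rightarrow> bool" where
  "real_bilinear_on S B \<longleftrightarrow>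
     (\<forall>u\<in>S. linear_on_set S (B u)) \<and> (\<forall>v\<in>S. linear_on_set S (\<lambda>u. B u v))"

definition Cinf_linear_on ::
  "('m, 'n::real_inner) chart set \<Rightarrow> ('m \<Rightarrow> 'a::real_vector) set \<Rightarrow>
   (('m \<Rightarrow> 'a) \<Rightarrow> ('m \<Rightarrow> 'b::real_vector)) \<Rightarrow> bool" where
  "Cinf_linear_on A S H \<longleftrightarrow>
     (\<forall>s\<in>S. \<forall>t\<in>S. H (s + t) = H s + H t) \<and> (\<forall>f\<in>Cinf A. \<forall>s\<in>S. H (f *\<^sub>F s) = f *\<^sub>F H s)"

definition anchor_app ::
  "('m, 'f) anchor \<Rightarrow> ('m, 'f) sec \<Rightarrow> ('m \<Rightarrow> real) \<Rightarrow> 'm \<Rightarrow> real" where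
  "anchor_app \<rho> u f = (\<lambda>p. \<rho> p (u p) f)"

definition E_differential ::
  "('m, 'f) vbundle \<Rightarrow> ('m, 'f) anchor \<Rightarrow> ('m \<Rightarrow> real) \<Rightarrow> ('m, 'f \<Rightarrow> real) sec" where
  "E_differential E \<rho> f = (\<lambda>p v. if v \<in> fibre E p then \<rho> p v f else 0)"

definition almost_leibniz_algebroid ::
  "('m, 'n::real_inner) chart set \<Rightarrow> ('m, 'f::real_vector) vbundle \<Rightarrow> ('m, 'f) anchor \<Rightarrow>
   ('m, 'f) secop \<Rightarrow> bool" where
  "almost_leibniz_algebroid A E \<rho> br \<longleftrightarrow>
     vb_morphism A E (tangent_bundle A) \<rho> \<and>
     br \<in> sections A E \<rightarrow> sections A E \<rightarrow> sections A E \<and>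
     real_bilinear_on (sections A E) br \<and>
     (\<forall>u\<in>sections A E. \<forall>v\<in>sections A E. \<forall>f\<in>Cinf A.
        br u (f *\<^sub>F v) = anchor_app \<rho> u f *\<^sub>F v + f *\<^sub>F br u v)"

definition almost_lie_algebroid ::
  "('m, 'n::real_inner) chart set \<Rightarrow> ('m, 'f::real_vector) vbundle \<Rightarrow> ('m, 'f) anchor \<Rightarrow>
   ('m, 'f) secop \<Rightarrow> bool" where
  "almost_lie_algebroid A E \<rho> br \<longleftrightarrow>
     almost_leibniz_algebroid A E \<rho> br \<and>
     (\<forall>u\<in>sections A E. \<forall>v\<in>sections A E. br u v = - br v u)"

definition local_almost_leibniz_algebroid ::
  "('m, 'n::real_inner) chart set \<Rightarrow> ('m, 'f::real_vector) vbundle \<Rightarrow> ('m, 'f) anchor \<Rightarrow>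
   ('m, 'f) secop \<Rightarrow> ('m, 'f) locop \<Rightarrow> bool" where
  "local_almost_leibniz_algebroid A E \<rho> br L \<longleftrightarrow>
     almost_leibniz_algebroid A E \<rho> br \<and>
     L \<in> sections A (dual_bundle E) \<rightarrow> sections A E \<rightarrow> sections A E \<rightarrow> sections A E \<and>
     (\<forall>u\<in>sections A E. \<forall>v\<in>sections A E.
        Cinf_linear_on A (sections A (dual_bundle E)) (\<lambda>\<alpha>. L \<alpha> u v)) \<and>
     (\<forall>\<alpha>\<in>sections A (dual_bundle E). \<forall>v\<in>sections A E.
        Cinf_linear_on A (sections A E) (\<lambda>u. L \<alpha> u v)) \<and>
     (\<forall>\<alpha>\<in>sections A (dual_bundle E). \<forall>u\<in>sections A E.
        Cinf_linear_on A (sections A E) (\<lambda>v. L \<alpha> u v)) \<and>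
     (\<forall>u\<in>sections A E. \<forall>v\<in>sections A E. \<forall>f\<in>Cinf A.
        br (f *\<^sub>F u) v = - (anchor_app \<rho> v f *\<^sub>F u) + f *\<^sub>F br u v + L (E_differential E \<rho> f) u v)"


section \<open>Connections\<close>

text \<open>
  Maps on \<open>\<Gamma>(E) \<times> \<Gamma>(E)\<close> are represented by extensional functions, so that two connections are
  equal as soon as they agree on sections.
\<close>

definition E_connection ::
  "('m, 'n::real_inner) chart set \<Rightarrow> ('m, 'f::real_vector) vbundle \<Rightarrow> ('m, 'f) anchor \<Rightarrow>
   ('m, 'f) secop \<Rightarrow> bool" where
  "E_connection A E \<rho> D \<longleftrightarrow>
     D \<in> sections A E \<rightarrow>\<^sub>E sections A E \<rightarrow>\<^sub>E sections A E \<and>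
     real_bilinear_on (sections A E) D \<and>
     (\<forall>u\<in>sections A E. \<forall>v\<in>sections A E. \<forall>f\<in>Cinf A.
        D u (f *\<^sub>F v) = anchor_app \<rho> u f *\<^sub>F v + f *\<^sub>F D u v \<and>
        D (f *\<^sub>F u) v = f *\<^sub>F D u v)"

text \<open>
  \<open>L\<close> and \<open>D\<close> act on global sections, so a local frame around \<open>p\<close> and its dual coframe are
  represented by global sections \<open>X a\<close>, \<open>e a\<close> that restrict to them on a neighbourhood of \<open>p\<close>;
  as \<open>L\<close> and \<open>D\<close> are local operators, \<open>L(e^a, D_{X_a} u, v)\<close> at \<open>p\<close> depends only on this
  restriction, and it does not depend on the frame.
\<close>

definition local_frame_near ::
  "('m::topological_space, 'n::real_inner) chart set \<Rightarrow> ('m, 'f::real_vector) vbundle \<Rightarrow> 'm \<Rightarrow>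
   (nat \<Rightarrow> ('m, 'f) sec) \<Rightarrow> (nat \<Rightarrow> ('m, 'f \<Rightarrow> real) sec) \<Rightarrow> bool" where
  "local_frame_near A E p X e \<longleftrightarrow>
     (\<forall>a<rank E. X a \<in> sections A E \<and> e a \<in> sections A (dual_bundle E)) \<and>
     (\<exists>W. open W \<and> p \<in> W \<and> (\<forall>q\<in>W. is_basis (fibre E q) (rank E) (\<lambda>a. X a q) \<and>
        (\<forall>a<rank E. e a q = coframe (rank E) X a q)))"

definition loc_term ::
  "('m::topological_space, 'n::real_inner) chart set \<Rightarrow> ('m, 'f::real_vector) vbundle \<Rightarrow>
   ('m, 'f) locop \<Rightarrow> ('m, 'f) secop \<Rightarrow> ('m, 'f) secop" where
  "loc_term A E L D u v = (\<lambda>p.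
     let (X, e) = (SOME (X, e). local_frame_near A E p X e)
     in (\<Sum>a<rank E. L (e a) (D (X a) u) v p))"

definition admissible ::
  "('m::topological_space, 'n::real_inner) chart set \<Rightarrow> ('m, 'f::real_vector) vbundle \<Rightarrow>
   ('m, 'f) secop \<Rightarrow> ('m, 'f) locop \<Rightarrow> ('m, 'f) secop \<Rightarrow> bool" where
  "admissible A E br L D \<longleftrightarrow>
     (\<forall>u\<in>sections A E. \<forall>v\<in>sections A E.
        br u v + br v u = loc_term A E L D u v + loc_term A E L D v u)"

definition modified_bracket ::
  "('m::topological_space, 'n::real_inner) chart set \<Rightarrow> ('m, 'f::real_vector) vbundle \<Rightarrow>
   ('m, 'f) secop \<Rightarrow> ('m, 'f) locop \<Rightarrow> ('m, 'f) secop \<Rightarrow> ('m, 'f) secop" where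
  "modified_bracket A E br L D u v = br u v - loc_term A E L D u v"

definition E_torsion ::
  "('m::topological_space, 'n::real_inner) chart set \<Rightarrow> ('m, 'f::real_vector) vbundle \<Rightarrow>
   ('m, 'f) secop \<Rightarrow> ('m, 'f) locop \<Rightarrow> ('m, 'f) secop \<Rightarrow> ('m, 'f) secop" where
  "E_torsion A E br L D u v = D u v - D v u - modified_bracket A E br L D u v"

definition metric_app ::
  "('m \<Rightarrow> 'f \<Rightarrow> 'f \<Rightarrow> real) \<Rightarrow> ('m, 'f) sec \<Rightarrow> ('m, 'f) sec \<Rightarrow> 'm \<Rightarrow> real" where
  "metric_app g u v = (\<lambda>p. g p (u p) (v p))"

definition E_nonmetricity ::
  "('m, 'f) anchor \<Rightarrow> ('m, 'f) secop \<Rightarrow> ('m \<Rightarrow> 'f \<Rightarrow> 'f \<Rightarrow> real) \<Rightarrow>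
   ('m, 'f) sec \<Rightarrow> ('m, 'f) sec \<Rightarrow> ('m, 'f) sec \<Rightarrow> 'm \<Rightarrow> real" where
  "E_nonmetricity \<rho> D g u v w =
     anchor_app \<rho> u (metric_app g v w) - metric_app g (D u v) w - metric_app g v (D u w)"

text \<open>
  Meant for an almost-Lie algebroid, with zero locality operator, so that the torsion is taken with
  respect to \<open>br\<close> itself.
\<close>

definition is_levi_civita ::
  "('m, 'n::real_inner) chart set \<Rightarrow> ('m, 'f::real_vector) vbundle \<Rightarrow> ('m, 'f) anchor \<Rightarrow>
   ('m, 'f) secop \<Rightarrow> ('m \<Rightarrow> 'f \<Rightarrow> 'f \<Rightarrow> real) \<Rightarrow> ('m, 'f) secop \<Rightarrow> bool" where
  "is_levi_civita A E \<rho> br g D \<longleftrightarrow>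
     E_connection A E \<rho> D \<and>
     (\<forall>u\<in>sections A E. \<forall>v\<in>sections A E. D u v - D v u = br u v) \<and>
     (\<forall>u\<in>sections A E. \<forall>v\<in>sections A E. \<forall>w\<in>sections A E. E_nonmetricity \<rho> D g u v w = 0)"

definition levi_civita ::
  "('m, 'n::real_inner) chart set \<Rightarrow> ('m, 'f::real_vector) vbundle \<Rightarrow> ('m, 'f) anchor \<Rightarrow>
   ('m, 'f) secop \<Rightarrow> ('m \<Rightarrow> 'f \<Rightarrow> 'f \<Rightarrow> real) \<Rightarrow> ('m, 'f) secop" where
  "levi_civita A E \<rho> br g = (THE D. is_levi_civita A E \<rho> br g D)"

end

theory Submission
  imports Defs "HOL-Real_Asymp.Real_Asymp" "Jordan_Normal_Form.Determinant"
begin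

text \<open>
  The connection \<open>D\<close> differs from the Levi-Civita connection of the modified bracket by a tensor: the form
  \<open>S(u,v,w) = Q(u,v,w) + Q(v,u,w) - Q(w,u,v) + g(T(v,w),u) + g(T(u,w),v) - g(T(u,v),w)\<close> is
  \<open>C^\<infinity>\<close>-linear in all arguments, so raising its last index gives a tensor \<open>K\<close> with
  \<open>2 g(K(u,v),w) = S(u,v,w)\<close>. The symmetries of \<open>S\<close> say that \<open>D + K\<close> is torsion-free and metric,
  hence it is the Levi-Civita connection, and the formula is the definition of \<open>K\<close>.

  Two facts make this meaningful on global sections: a \<open>C^\<infinity>\<close>-linear operator on sections is pointwise
  (bump functions), so that the contraction in the modified bracket is independent of the frame and
  smooth; and Cramer's rule, which shows that raising an index preserves smoothness.
\<close>

section \<open>Functions of class \<open>C^k\<close>\<close>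

text \<open>A direct construction from the Koszul formula would require both Leibniz rules to be
  checked on an expression full of anchor and bracket terms. Starting from \<open>D\<close> avoids
  this: a tensor is added to a connection, so \<open>D + K\<close> inherits its Leibniz rules. The
  form S is forced: torsion-freeness asks for K(v,u) - K(u,v) = T(u,v), metricity for g(K(u,v),w) +
  g(K(u,w),v) = Q(u,v,w), and an alternating sum over permutations of u, v, w solves these for 2
  g(K(u,v),w).

  Two obstacles shape the rest. \<open>L\<close> and \<open>D\<close> accept only global sections
  while frames are local, and \<open>loc_term\<close> chooses its frame separately at each point, so
  not even continuity of the modified bracket is visible from its definition. Also, g is merely
  nondegenerate, so that Gram-Schmidt may meet null vectors; hence the determinants. Since
  \<open>levi_civita\<close> is a definite description, uniqueness has to be proved along with
  existence.\<close>

lemma Ck_on_subset: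
  assumes "Ck_on k T f" "S \<subseteq> T"
  shows "Ck_on k S f"
  using assms by (induction k arbitrary: f) (auto intro: continuous_on_subset)

lemma Ck_on_SucD: "Ck_on (Suc k) S f \<Longrightarrow> Ck_on k S f"
proof (induction k arbitrary: f)
  case 0
  then show ?case
    by (auto intro!: continuous_at_imp_continuous_on differentiable_imp_continuous_within)
next
  case (Suc k)
  then have "Ck_on (Suc k) S (\<lambda>x. frechet_derivative f (at x) v)" for v
    unfolding Ck_on.simps(2)[of "Suc k"] by blast
  then have "Ck_on k S (\<lambda>x. frechet_derivative f (at x) v)" for v
    by (rule Suc.IH)
  with Suc.prems show ?case
    by simp
qed

text \<open>\<open>Ck_on\<close> uses full derivatives \<open>at x\<close>, not derivatives within
  \<open>S\<close>. The values on \<open>S\<close> determine them because each point of the open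
  \<open>S\<close> has a neighbourhood inside \<open>S\<close>.\<close>

lemma Ck_on_cong_imp:
  assumes "open S" "\<And>x. x \<in> S \<Longrightarrow> f x = g x" "Ck_on k S f"
  shows "Ck_on k S g"
  using assms(2,3)
proof (induction k arbitrary: f g)
  case 0
  then show ?case by (simp cong: continuous_on_cong)
next
  case (Suc k)
  have d: "(g has_derivative frechet_derivative f (at x)) (at x)" if "x \<in> S" for x
    by (rule has_derivative_transform_within_open[of f _ x UNIV S, simplified])
      (use Suc.prems that \<open>open S\<close> in \<open>auto simp: frechet_derivative_works\<close>)
  then have "frechet_derivative f (at x) = frechet_derivative g (at x)" if "x \<in> S" for x
    using frechet_derivative_at[OF d[OF that]] by simp
  then have "Ck_on k S (\<lambda>x. frechet_derivative g (at x) v)" for v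
    using Suc.IH[of "\<lambda>x. frechet_derivative f (at x) v"] Suc.prems by simp
  with d show ?case
    by (auto simp: differentiable_def)
qed

lemma Ck_on_cong:
  assumes "open S" "\<And>x. x \<in> S \<Longrightarrow> f x = g x"
  shows "Ck_on k S f \<longleftrightarrow> Ck_on k S g"
  using Ck_on_cong_imp[OF assms(1), of f g] Ck_on_cong_imp[OF assms(1), of g f] assms(2) by auto

text \<open>\<open>frechet_derivative\<close> is a choice operator. This rule accepts an explicit
  derivative formula, which uniqueness of derivatives identifies with the chosen one.\<close>

lemma Ck_on_SucI:
  assumes "open S" "\<And>x. x \<in> S \<Longrightarrow> (f has_derivative f' x) (at x)"
    "\<And>v. Ck_on k S (\<lambda>x. f' x v)"
  shows "Ck_on (Suc k) S f"
proof -
  have "f' x v = frechet_derivative f (at x) v" if "x \<in> S" for x v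
    using frechet_derivative_at[OF assms(2)[OF that]] by simp
  then have "Ck_on k S (\<lambda>x. frechet_derivative f (at x) v)" for v
    using Ck_on_cong_imp[OF \<open>open S\<close> _ assms(3)[of v]] by simp
  with assms(2) show ?thesis
    by (auto simp: differentiable_def)
qed

lemma Ck_on_Suc_has_derivative:
  "Ck_on (Suc k) S f \<Longrightarrow> x \<in> S \<Longrightarrow> (f has_derivative frechet_derivative f (at x)) (at x)"
  by (simp add: frechet_derivative_works)

lemma Ck_on_const: "open S \<Longrightarrow> Ck_on k S (\<lambda>x. c)"
  by (induction k arbitrary: c) (auto simp: frechet_derivative_const)

lemma Ck_on_add:
  assumes "open S" "Ck_on k S f" "Ck_on k S g"
  shows "Ck_on k S (\<lambda>x. f x + g x)"
  using assms(2,3)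
proof (induction k arbitrary: f g)
  case 0
  then show ?case by (simp add: continuous_on_add)
next
  case (Suc k)
  show ?case
    by (rule Ck_on_SucI[OF \<open>open S\<close>])
      (use Suc in \<open>auto intro!: has_derivative_add simp: frechet_derivative_works\<close>)
qed

text \<open>Product rule: in each summand one factor is differentiated and the other is merely
  lowered from order \<open>Suc k\<close> to \<open>k\<close>, so the induction hypothesis covers
  both. Multiplication, scaling and the inner product of the model space are the instances
  used.\<close>

lemma Ck_on_bilinear:
  assumes "bounded_bilinear B" "open S" "Ck_on k S f" "Ck_on k S g"
  shows "Ck_on k S (\<lambda>x. B (f x) (g x))"
  using assms(3,4)
proof (induction k arbitrary: f g)
  case 0
  then show ?case by (simp add: bounded_bilinear.continuous_on[OF assms(1)])
next
  case (Suc k)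
  show ?case
  proof (rule Ck_on_SucI[OF \<open>open S\<close>])
    show "((\<lambda>x. B (f x) (g x)) has_derivative
      (\<lambda>h. B (f x) (frechet_derivative g (at x) h) + B (frechet_derivative f (at x) h) (g x))) (at x)"
      if "x \<in> S" for x
      by (rule bounded_bilinear.FDERIV[OF assms(1) Ck_on_Suc_has_derivative[OF Suc.prems(1) that]
            Ck_on_Suc_has_derivative[OF Suc.prems(2) that]])
    show "Ck_on k S (\<lambda>x. B (f x) (frechet_derivative g (at x) v) + B (frechet_derivative f (at x) v) (g x))" for v
      using Suc.IH Suc.prems Ck_on_SucD[OF Suc.prems(1)] Ck_on_SucD[OF Suc.prems(2)]
      by (intro Ck_on_add[OF \<open>open S\<close>]) auto
  qed
qed

lemma Ck_on_mult:
  fixes f g :: "'a::real_normed_vector \<Rightarrow> real"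
  shows "open S \<Longrightarrow> Ck_on k S f \<Longrightarrow> Ck_on k S g \<Longrightarrow> Ck_on k S (\<lambda>x. f x * g x)"
  by (rule Ck_on_bilinear[OF bounded_bilinear_mult])

text \<open>The derivative of 1/f is a product of 1/f, f' and 1/f, so the induction hypothesis for
  1/f itself closes the step.\<close>

lemma Ck_on_inverse:
  fixes f :: "'a::real_normed_vector \<Rightarrow> real"
  assumes "open S" "\<And>x. x \<in> S \<Longrightarrow> f x \<noteq> 0" "Ck_on k S f"
  shows "Ck_on k S (\<lambda>x. inverse (f x))"
  using assms(3)
proof (induction k)
  case 0
  then show ?case using assms(2) by (auto intro!: continuous_intros)
next
  case (Suc k)
  show ?case
  proof (rule Ck_on_SucI[OF \<open>open S\<close>])
    show "((\<lambda>x. inverse (f x)) has_derivative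
      (\<lambda>h. - (inverse (f x) * frechet_derivative f (at x) h * inverse (f x)))) (at x)"
      if "x \<in> S" for x
      by (rule Deriv.has_derivative_inverse[OF assms(2)[OF that] Ck_on_Suc_has_derivative[OF Suc.prems that]])
    have IH: "Ck_on k S (\<lambda>x. inverse (f x))"
      by (rule Suc.IH[OF Ck_on_SucD[OF Suc.prems]])
    have "Ck_on k S (\<lambda>x. frechet_derivative f (at x) v)" for v
      using Suc.prems by simp
    then have "Ck_on k S (\<lambda>x. (- 1) * (inverse (f x) * frechet_derivative f (at x) v * inverse (f x)))" for v
      by (intro Ck_on_mult Ck_on_const IH \<open>open S\<close>)
    then show "Ck_on k S (\<lambda>x. - (inverse (f x) * frechet_derivative f (at x) v * inverse (f x)))" for v
      by simp
  qed
qed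

text \<open>With an outer function of one real variable, h'(y) t equals t times h'(y) 1, so the
  chain rule yields an ordinary product. The induction generalises over \<open>h\<close> because h
  is replaced by its derivative.\<close>

lemma Ck_on_compose_real:
  fixes f :: "'a::real_normed_vector \<Rightarrow> real" and h :: "real \<Rightarrow> real"
  assumes "open S" "Ck_on k UNIV h" "Ck_on k S f"
  shows "Ck_on k S (\<lambda>x. h (f x))"
  using assms(2,3)
proof (induction k arbitrary: f h)
  case 0
  then show ?case
    by (auto intro: continuous_on_compose2)
next
  case (Suc k)
  show ?case
  proof (rule Ck_on_SucI[OF \<open>open S\<close>])
    show "((\<lambda>x. h (f x)) has_derivative
      (\<lambda>v. frechet_derivative f (at x) v * frechet_derivative h (at (f x)) 1)) (at x)"
      if "x \<in> S" for x
    proof -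
      have h: "(h has_derivative frechet_derivative h (at (f x))) (at (f x))"
        using Suc.prems(1) by (rule Ck_on_Suc_has_derivative) simp
      have lin: "frechet_derivative h (at (f x)) t = t * frechet_derivative h (at (f x)) 1" for t
        using linear_cmul[OF has_derivative_linear[OF h], of t 1] by simp
      show ?thesis
        by (rule has_derivative_eq_rhs[OF has_derivative_compose[OF
                Ck_on_Suc_has_derivative[OF Suc.prems(2) that] h]]) (rule ext, rule lin)
    qed
    show "Ck_on k S (\<lambda>x. frechet_derivative f (at x) v * frechet_derivative h (at (f x)) 1)" for v
      using Suc.prems Ck_on_SucD[OF Suc.prems(2)]
      by (intro Ck_on_mult[OF \<open>open S\<close>] Suc.IH[of "\<lambda>y. frechet_derivative h (at y) 1"]) auto
  qed
qed

lemma Ck_on_local: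
  assumes "\<And>x. x \<in> S \<Longrightarrow> \<exists>W. open W \<and> x \<in> W \<and> Ck_on k (S \<inter> W) f"
  assumes "open S"
  shows "Ck_on k S f"
  using assms(1)
proof (induction k arbitrary: f)
  case 0
  have "continuous (at x within S) f" if x: "x \<in> S" for x
  proof -
    obtain W where W: "open W" "x \<in> W" "continuous_on (S \<inter> W) f"
      using 0 x by auto
    then have "continuous (at x) f"
      using \<open>open S\<close> x by (metis IntI continuous_on_eq_continuous_at open_Int)
    then show ?thesis
      by (rule continuous_at_imp_continuous_within)
  qed
  then show ?case by (simp add: continuous_on_eq_continuous_within)
next
  case (Suc k)
  have "f differentiable (at x)" if "x \<in> S" for x
    using Suc.prems[OF that] that by auto
  moreover have "Ck_on k S (\<lambda>x. frechet_derivative f (at x) v)" for v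
  proof (rule Suc.IH)
    show "\<exists>W. open W \<and> x \<in> W \<and> Ck_on k (S \<inter> W) (\<lambda>x. frechet_derivative f (at x) v)" if "x \<in> S" for x
      using Suc.prems[OF that] by auto
  qed
  ultimately show ?case by simp
qed

section \<open>Smooth maps: closure properties inherited from all orders \<open>k\<close>\<close>

lemma smooth_on_subset: "smooth_on T f \<Longrightarrow> S \<subseteq> T \<Longrightarrow> smooth_on S f"
  unfolding smooth_on_def using Ck_on_subset by blast

lemma smooth_on_cong:
  "open S \<Longrightarrow> (\<And>x. x \<in> S \<Longrightarrow> f x = g x) \<Longrightarrow> smooth_on S f \<longleftrightarrow> smooth_on S g"
  unfolding smooth_on_def using Ck_on_cong by blast

lemma smooth_on_const: "open S \<Longrightarrow> smooth_on S (\<lambda>x. c)"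
  unfolding smooth_on_def using Ck_on_const by blast

lemma smooth_on_add:
  "open S \<Longrightarrow> smooth_on S f \<Longrightarrow> smooth_on S g \<Longrightarrow> smooth_on S (\<lambda>x. f x + g x)"
  unfolding smooth_on_def using Ck_on_add by blast

lemma smooth_on_bilinear:
  "bounded_bilinear B \<Longrightarrow> open S \<Longrightarrow> smooth_on S f \<Longrightarrow> smooth_on S g \<Longrightarrow>
    smooth_on S (\<lambda>x. B (f x) (g x))"
  unfolding smooth_on_def using Ck_on_bilinear by blast

lemma smooth_on_mult:
  fixes f g :: "'a::real_normed_vector \<Rightarrow> real"
  shows "open S \<Longrightarrow> smooth_on S f \<Longrightarrow> smooth_on S g \<Longrightarrow> smooth_on S (\<lambda>x. f x * g x)"
  by (rule smooth_on_bilinear[OF bounded_bilinear_mult])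

lemma smooth_on_sum:
  assumes "open S" "\<And>i. i \<in> I \<Longrightarrow> smooth_on S (f i)"
  shows "smooth_on S (\<lambda>x. \<Sum>i\<in>I. f i x)"
  using assms(2)
  by (induction I rule: infinite_finite_induct)
    (auto intro: smooth_on_const[OF assms(1)] smooth_on_add[OF assms(1)])

lemma smooth_on_diff:
  fixes f g :: "'a::real_normed_vector \<Rightarrow> 'b::real_normed_vector"
  assumes "open S" "smooth_on S f" "smooth_on S g"
  shows "smooth_on S (\<lambda>x. f x - g x)"
  using smooth_on_add[OF assms(1,2) smooth_on_bilinear[OF bounded_bilinear_scaleR assms(1)
      smooth_on_const[OF assms(1), of "- 1"] assms(3)]] by simp

lemma smooth_on_inverse:
  fixes f :: "'a::real_normed_vector \<Rightarrow> real"
  shows "open S \<Longrightarrow> (\<And>x. x \<in> S \<Longrightarrow> f x \<noteq> 0) \<Longrightarrow> smooth_on S f \<Longrightarrow>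
    smooth_on S (\<lambda>x. inverse (f x))"
  unfolding smooth_on_def using Ck_on_inverse by blast

lemma smooth_on_compose_real:
  fixes f :: "'a::real_normed_vector \<Rightarrow> real" and h :: "real \<Rightarrow> real"
  shows "open S \<Longrightarrow> smooth_on UNIV h \<Longrightarrow> smooth_on S f \<Longrightarrow> smooth_on S (\<lambda>x. h (f x))"
  unfolding smooth_on_def using Ck_on_compose_real by blast

lemma smooth_on_local:
  "(\<And>x. x \<in> S \<Longrightarrow> \<exists>W. open W \<and> x \<in> W \<and> smooth_on (S \<inter> W) f) \<Longrightarrow> open S \<Longrightarrow> smooth_on S f"
  unfolding smooth_on_def by (meson Ck_on_local)

lemma smooth_on_directional:
  "smooth_on S f \<Longrightarrow> smooth_on S (\<lambda>x. frechet_derivative f (at x) v)"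
  unfolding smooth_on_def by (metis Ck_on.simps(2))

lemma smooth_on_ident:
  assumes "open S"
  shows "smooth_on S (\<lambda>x. x)"
  unfolding smooth_on_def
proof
  show "Ck_on k S (\<lambda>x. x)" for k
  proof (cases k)
    case (Suc j)
    show ?thesis
      unfolding Suc
      by (rule Ck_on_SucI[OF assms has_derivative_ident Ck_on_const[OF assms]])
  qed simp
qed


section \<open>Bump functions\<close>

text \<open>The family is closed under differentiation up to linear combinations.\<close>

definition flat_exp :: "nat \<Rightarrow> real \<Rightarrow> real" where
  "flat_exp n t = (if t \<le> 0 then 0 else exp (- inverse t) * inverse t ^ n)"

text \<open>The exponential exp(-1/t) beats every power of 1/t as t decreases to 0; from the left
  the function is identically 0. This is all that differentiability at 0 needs.\<close>

lemma flat_exp_tendsto_0: "(flat_exp n \<longlongrightarrow> 0) (at 0)"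
proof -
  have "(flat_exp n \<longlongrightarrow> 0) (at_left 0)"
    by (rule tendsto_eventually)
      (auto simp: eventually_at_filter flat_exp_def)
  moreover have "((\<lambda>t::real. exp (- inverse t) * inverse t ^ n) \<longlongrightarrow> 0) (at_right 0)"
    by real_asymp
  then have "(flat_exp n \<longlongrightarrow> 0) (at_right 0)"
    by (rule Lim_transform_eventually)
      (auto simp: eventually_at_filter flat_exp_def)
  ultimately show ?thesis
    using filterlim_split_at by blast
qed

lemma flat_exp_has_real_derivative:
  "(flat_exp n has_real_derivative flat_exp (n + 2) t - real n * flat_exp (n + 1) t) (at t)"
proof -
  consider "t < 0" | "t = 0" | "t > 0" by linarith
  then show ?thesis
  proof cases
    case 1
    have "((\<lambda>t. 0) has_real_derivative 0) (at t)" by simp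
    then have "(flat_exp n has_real_derivative 0) (at t)"
      by (rule has_field_derivative_transform_within_open[where S = "{..<0}"]) (use 1 in \<open>auto simp: flat_exp_def\<close>)
    then show ?thesis using 1 by (simp add: flat_exp_def)
  next
    case 2
    \<comment> \<open>For nonzero h the difference quotient of \<open>flat_exp n\<close> at 0 is
      \<open>flat_exp (n + 1) h\<close>, so the preceding limit gives derivative 0.\<close>
    have "((\<lambda>h. (flat_exp n (0 + h) - flat_exp n 0) / h) \<longlongrightarrow> 0) (at 0)"
      by (rule Lim_transform_eventually[OF flat_exp_tendsto_0[of "n + 1"]])
        (auto simp: eventually_at flat_exp_def divide_inverse intro!: exI[of _ 1])
    then show ?thesis using 2 by (simp add: DERIV_def flat_exp_def)
  next
    case 3
    have "((\<lambda>t. exp (- inverse t) * inverse t ^ n) has_real_derivative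
        flat_exp (n + 2) t - real n * flat_exp (n + 1) t) (at t)"
    proof (cases n)
      case 0
      then show ?thesis using 3
        by (auto intro!: derivative_eq_intros simp: flat_exp_def power2_eq_square)
    next
      case (Suc m)
      then show ?thesis using 3
        by (auto intro!: derivative_eq_intros
            simp: flat_exp_def power2_eq_square algebra_simps simp flip: power_Suc)
    qed
    then show ?thesis
      by (rule has_field_derivative_transform_within_open[where S = "{0<..}"]) (use 3 in \<open>auto simp: flat_exp_def\<close>)
  qed
qed

lemma smooth_on_flat_exp: "smooth_on UNIV (flat_exp n)"
  unfolding smooth_on_def
proof
  show "Ck_on k UNIV (flat_exp n)" for k
  proof (induction k arbitrary: n)
    case 0
    then show ?case
      using DERIV_continuous[OF flat_exp_has_real_derivative]
      by (auto intro!: continuous_at_imp_continuous_on)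
  next
    case (Suc k)
    show ?case
    proof (rule Ck_on_SucI)
      show "(flat_exp n has_derivative
        (*) (flat_exp (n + 2) t + - real n * flat_exp (n + 1) t)) (at t)" for t
        using flat_exp_has_real_derivative[of n t] by (simp add: has_field_derivative_def)
      show "Ck_on k UNIV (\<lambda>t. (flat_exp (n + 2) t + - real n * flat_exp (n + 1) t) * v)" for v
        by (intro Ck_on_mult Ck_on_add Ck_on_const Suc) auto
    qed auto
  qed
qed

text \<open>The witness is h(t) / (h(t) + h(c - t)) with h = \<open>flat_exp 0\<close>. The
  denominator is positive because t and c - t cannot both be nonpositive; for t \<ge> c its second
  summand vanishes and the quotient is 1.\<close>

lemma smooth_step_exists:
  assumes "c > 0"
  obtains \<sigma> :: "real \<Rightarrow> real" where "smooth_on UNIV \<sigma>" "\<And>t. t \<le> 0 \<Longrightarrow> \<sigma> t = 0"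
    "\<And>t. t \<ge> c \<Longrightarrow> \<sigma> t = 1"
proof
  let ?h = "flat_exp 0"
  let ?\<sigma> = "\<lambda>t. ?h t * inverse (?h t + ?h (c - t))"
  have ge: "?h t \<ge> 0" and pos: "t > 0 \<Longrightarrow> ?h t > 0" for t
    by (auto simp: flat_exp_def)
  have "?h t + ?h (c - t) > 0" for t
    using ge[of t] ge[of "c - t"] pos[of t] pos[of "c - t"] assms by (smt (verit))
  then have "?h t + ?h (c - t) \<noteq> 0" for t
    by (metis less_irrefl)
  then show "smooth_on UNIV ?\<sigma>"
    by (intro smooth_on_mult smooth_on_inverse smooth_on_add smooth_on_flat_exp
        smooth_on_compose_real[OF _ smooth_on_flat_exp] smooth_on_diff smooth_on_const smooth_on_ident)
      auto
  show "?\<sigma> t = 0" if "t \<le> 0" for t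
    using that by (simp add: flat_exp_def)
  show "?\<sigma> t = 1" if "t \<ge> c" for t
    using that assms by (simp add: flat_exp_def)
qed

text \<open>Heine-Borel for a space whose finite dimension is a hypothesis and not a type class: the
  ball is a closed subset of a box of bounded coordinates in an orthogonal spanning set, and the box
  is compact. Bump functions need it to get closed supports.\<close>

lemma compact_cball_finite_span:
  fixes x0 :: "'n::real_inner"
  assumes "finite B" "span B = (UNIV :: 'n set)"
  shows "compact (cball x0 r)"
proof -
  obtain C :: "'n set" where C: "finite C" "span C = UNIV" "pairwise real_inner_class.orthogonal C"
    using basis_orthogonal[OF assms(1)] assms(2) by metis
  \<comment> \<open>Zero is dropped so that b \<bullet> b can be divided by.\<close>
  define D where "D = C - {0}"
  have D: "finite D" "span D = UNIV" "pairwise real_inner_class.orthogonal D" "0 \<notin> D"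
    using C by (auto simp: D_def intro: pairwise_subset)
  \<comment> \<open>Cauchy-Schwarz bound for the coordinate (x \<bullet> b) / (b \<bullet> b) of a
    point with norm at most \<open>norm x0 + \<bar>r\<bar>\<close>.\<close>
  define R where "R b = (norm x0 + \<bar>r\<bar>) * norm b / (b \<bullet> b)" for b :: 'n
  define box where "box F = {\<Sum>b\<in>F. c b *\<^sub>R b |c. \<forall>b\<in>F. \<bar>c b\<bar> \<le> R b}" for F :: "'n set"
  have "compact (box F)" if "finite F" for F
    using that
  proof (induction F)
    case empty
    then show ?case by (simp add: box_def)
  next
    case (insert a F)
    \<comment> \<open>One more vector adds a compact segment, and a sum of compact sets is
      compact.\<close>
    have "box (insert a F) = {x + y |x y. x \<in> (\<lambda>t. t *\<^sub>R a) ` {- R a..R a} \<and> y \<in> box F}"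
    proof (rule Set.set_eqI, rule iffI)
      fix z assume "z \<in> box (insert a F)"
      then obtain c where "z = (\<Sum>b\<in>insert a F. c b *\<^sub>R b)" "\<forall>b\<in>insert a F. \<bar>c b\<bar> \<le> R b"
        by (auto simp: box_def)
      then have "z = c a *\<^sub>R a + (\<Sum>b\<in>F. c b *\<^sub>R b)" "c a \<in> {- R a..R a}"
        "(\<Sum>b\<in>F. c b *\<^sub>R b) \<in> box F"
        using insert.hyps by (auto simp: box_def abs_le_iff)
      then show "z \<in> {x + y |x y. x \<in> (\<lambda>t. t *\<^sub>R a) ` {- R a..R a} \<and> y \<in> box F}"
        by blast
    next
      fix z assume "z \<in> {x + y |x y. x \<in> (\<lambda>t. t *\<^sub>R a) ` {- R a..R a} \<and> y \<in> box F}"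
      then obtain t c where "z = t *\<^sub>R a + (\<Sum>b\<in>F. c b *\<^sub>R b)" "\<bar>t\<bar> \<le> R a" "\<forall>b\<in>F. \<bar>c b\<bar> \<le> R b"
        by (auto simp: box_def abs_le_iff)
      moreover have "(\<Sum>b\<in>F. (c(a := t)) b *\<^sub>R b) = (\<Sum>b\<in>F. c b *\<^sub>R b)"
        using insert.hyps by (intro sum.cong) auto
      ultimately show "z \<in> box (insert a F)"
        using insert.hyps unfolding box_def by (auto intro!: exI[of _ "c(a := t)"])
    qed
    moreover have im: "compact ((\<lambda>t. t *\<^sub>R a) ` {- R a..R a})"
      by (intro compact_continuous_image continuous_intros compact_Icc)
    ultimately show ?case
      using compact_sums[OF im insert.IH] by simp
  qed
  then have "compact (box D)" using D by blast
  moreover have "cball x0 r \<subseteq> box D"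
  proof
    fix x assume "x \<in> cball x0 r"
    then have "dist x0 x \<le> r" by simp
    then have nx: "norm x \<le> norm x0 + \<bar>r\<bar>"
      using norm_triangle_sub[of x x0] by (simp add: dist_norm norm_minus_commute)
    have "x \<in> span D" using D by simp
    then obtain c where c: "x = (\<Sum>b\<in>D. c b *\<^sub>R b)"
      using span_finite[OF D(1)] by auto
    have "\<bar>c b\<bar> \<le> R b" if b: "b \<in> D" for b
    proof -
      have "x \<bullet> b = (\<Sum>a\<in>D. c a * (a \<bullet> b))"
        by (simp add: c inner_sum_left)
      also have "\<dots> = (\<Sum>a\<in>D. if a = b then c b * (b \<bullet> b) else 0)"
        using D(3) b by (intro sum.cong) (auto simp: pairwise_def real_inner_class.orthogonal_def)
      finally have "x \<bullet> b = c b * (b \<bullet> b)"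
        using D(1) b by simp
      moreover have "b \<bullet> b > 0" using b D(4) by auto
      ultimately have "\<bar>c b\<bar> = \<bar>x \<bullet> b\<bar> / (b \<bullet> b)"
        by (simp add: abs_mult)
      also have "\<dots> \<le> (norm x * norm b) / (b \<bullet> b)"
        by (intro divide_right_mono Cauchy_Schwarz_ineq2) auto
      also have "\<dots> \<le> R b"
        unfolding R_def using nx by (intro divide_right_mono mult_right_mono) auto
      finally show ?thesis .
    qed
    then show "x \<in> box D" using c unfolding box_def by blast
  qed
  ultimately show ?thesis
    using compact_Int_closed[of "box D" "cball x0 r"] by (simp add: Int_absorb1)
qed


section \<open>Smooth functions on a manifold\<close>

locale smooth_manifold =
  fixes A :: "('m::{t2_space,second_countable_topology}, 'n::real_inner) chart set"
  assumes atlas: "smooth_atlas A"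
begin

lemma chart_cover: "\<exists>U \<phi>. (U, \<phi>) \<in> A \<and> p \<in> U"
proof -
  have "p \<in> (\<Union>(U, \<phi>)\<in>A. U)"
    using atlas by (simp add: smooth_atlas_def)
  then show ?thesis by auto
qed

lemma
  assumes "(U, \<phi>) \<in> A"
  shows chart_open: "open U" and chart_image_open: "open (\<phi> ` U)"
    and chart_homeomorphism: "homeomorphism U (\<phi> ` U) \<phi> (inv_into U \<phi>)"
  using atlas[unfolded smooth_atlas_def, THEN conjunct2, THEN conjunct2, THEN conjunct1] assms
  by (auto dest!: bspec)

lemma chart_continuous:
  assumes "(U, \<phi>) \<in> A"
  shows "continuous_on U \<phi>" "continuous_on (\<phi> ` U) (inv_into U \<phi>)"
  using chart_homeomorphism[OF assms] by (auto simp: homeomorphism_def)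

lemma chart_inv:
  assumes "(U, \<phi>) \<in> A" "p \<in> U"
  shows "inv_into U \<phi> (\<phi> p) = p"
  using chart_homeomorphism[OF assms(1)] assms(2) by (auto simp: homeomorphism_def)

lemma chart_transition:
  "(U, \<phi>) \<in> A \<Longrightarrow> (V, \<psi>) \<in> A \<Longrightarrow> smooth_on (\<phi> ` (U \<inter> V)) (\<psi> \<circ> inv_into U \<phi>)"
  using atlas[unfolded smooth_atlas_def, THEN conjunct2, THEN conjunct2, THEN conjunct2]
  by (fastforce dest: bspec)

lemma chart_image_Int_open:
  assumes "(U, \<phi>) \<in> A" "open W"
  shows "open (\<phi> ` (U \<inter> W))"
proof -
  have "\<phi> ` (U \<inter> W) = \<phi> ` U \<inter> inv_into U \<phi> -` W"
    using chart_inv[OF assms(1)] by auto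
  then show ?thesis
    using continuous_open_preimage[OF chart_continuous(2)[OF assms(1)] chart_image_open[OF assms(1)]
        assms(2)] by simp
qed

lemma smooth_funI:
  "(\<And>U \<phi>. (U, \<phi>) \<in> A \<Longrightarrow> smooth_on (\<phi> ` (U \<inter> W)) (\<lambda>x. f (inv_into U \<phi> x))) \<Longrightarrow> smooth_fun A W f"
  unfolding smooth_fun_def comp_def by blast

lemma smooth_funD:
  "smooth_fun A W f \<Longrightarrow> (U, \<phi>) \<in> A \<Longrightarrow> smooth_on (\<phi> ` (U \<inter> W)) (\<lambda>x. f (inv_into U \<phi> x))"
  unfolding smooth_fun_def comp_def by blast

lemma smooth_fun_subset: "smooth_fun A W f \<Longrightarrow> V \<subseteq> W \<Longrightarrow> smooth_fun A V f"
  by (rule smooth_funI, drule smooth_funD, assumption, erule smooth_on_subset) auto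

lemma smooth_fun_cong:
  assumes "open W" "\<And>p. p \<in> W \<Longrightarrow> f p = g p" "smooth_fun A W f"
  shows "smooth_fun A W g"
proof (rule smooth_funI)
  fix U \<phi> assume U: "(U, \<phi>) \<in> A"
  have "f (inv_into U \<phi> x) = g (inv_into U \<phi> x)" if "x \<in> \<phi> ` (U \<inter> W)" for x
    using that chart_inv[OF U] assms(2) by auto
  then show "smooth_on (\<phi> ` (U \<inter> W)) (\<lambda>x. g (inv_into U \<phi> x))"
    using smooth_on_cong[OF chart_image_Int_open[OF U \<open>open W\<close>]] smooth_funD[OF assms(3) U]
    by (metis (no_types, lifting))
qed

lemma smooth_fun_const: "open W \<Longrightarrow> smooth_fun A W (\<lambda>p. c)"
  by (intro smooth_funI smooth_on_const chart_image_Int_open)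

lemma smooth_fun_add:
  "open W \<Longrightarrow> smooth_fun A W f \<Longrightarrow> smooth_fun A W g \<Longrightarrow> smooth_fun A W (\<lambda>p. f p + g p)"
  by (intro smooth_funI smooth_on_add chart_image_Int_open) (auto intro: smooth_funD)

lemma smooth_fun_mult:
  "open W \<Longrightarrow> smooth_fun A W f \<Longrightarrow> smooth_fun A W g \<Longrightarrow> smooth_fun A W (\<lambda>p. f p * g p)"
  by (intro smooth_funI smooth_on_mult chart_image_Int_open) (auto intro: smooth_funD)

lemma smooth_fun_inverse:
  assumes "open W" "smooth_fun A W f" "\<And>p. p \<in> W \<Longrightarrow> f p \<noteq> 0"
  shows "smooth_fun A W (\<lambda>p. inverse (f p))"
proof (rule smooth_funI)
  fix U \<phi> assume U: "(U, \<phi>) \<in> A"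
  show "smooth_on (\<phi> ` (U \<inter> W)) (\<lambda>x. inverse (f (inv_into U \<phi> x)))"
    using chart_inv[OF U] assms(3)
    by (intro smooth_on_inverse chart_image_Int_open[OF U \<open>open W\<close>] smooth_funD[OF assms(2) U]) auto
qed

lemma smooth_fun_uminus:
  "open W \<Longrightarrow> smooth_fun A W f \<Longrightarrow> smooth_fun A W (\<lambda>p. - f p)"
  using smooth_fun_mult[OF _ smooth_fun_const[of W "-1"]] by fastforce

lemma smooth_fun_diff:
  "open W \<Longrightarrow> smooth_fun A W f \<Longrightarrow> smooth_fun A W g \<Longrightarrow> smooth_fun A W (\<lambda>p. f p - g p)"
  using smooth_fun_add[OF _ _ smooth_fun_uminus] by fastforce

lemma smooth_fun_sum:
  assumes "open W" "\<And>i. i \<in> I \<Longrightarrow> smooth_fun A W (f i)"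
  shows "smooth_fun A W (\<lambda>p. \<Sum>i\<in>I. f i p)"
  using assms(2)
  by (induction I rule: infinite_finite_induct) (auto intro: smooth_fun_const smooth_fun_add assms(1))

lemma smooth_fun_prod:
  assumes "open W" "\<And>i. i \<in> I \<Longrightarrow> smooth_fun A W (f i)"
  shows "smooth_fun A W (\<lambda>p. \<Prod>i\<in>I. f i p)"
  using assms(2)
  by (induction I rule: infinite_finite_induct) (auto intro: smooth_fun_const smooth_fun_mult assms(1))

lemma smooth_fun_local:
  assumes "open W" "\<And>p. p \<in> W \<Longrightarrow> \<exists>V. open V \<and> p \<in> V \<and> smooth_fun A (W \<inter> V) f"
  shows "smooth_fun A W f"
proof (rule smooth_funI)
  fix U \<phi> assume U: "(U, \<phi>) \<in> A"
  show "smooth_on (\<phi> ` (U \<inter> W)) (\<lambda>x. f (inv_into U \<phi> x))"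
  proof (rule smooth_on_local)
    fix x assume "x \<in> \<phi> ` (U \<inter> W)"
    then obtain p where p: "p \<in> U" "p \<in> W" "x = \<phi> p" by blast
    obtain V where V: "open V" "p \<in> V" "smooth_fun A (W \<inter> V) f"
      using assms(2)[OF p(2)] by blast
    \<comment> \<open>A chart is injective on its domain, so images commute with
      intersections.\<close>
    have "\<phi> ` (U \<inter> W) \<inter> \<phi> ` (U \<inter> V) \<subseteq> \<phi> ` (U \<inter> (W \<inter> V))"
    proof
      fix z assume "z \<in> \<phi> ` (U \<inter> W) \<inter> \<phi> ` (U \<inter> V)"
      then obtain a b where "a \<in> U" "a \<in> W" "b \<in> U" "b \<in> V" "z = \<phi> a" "z = \<phi> b"
        by blast
      moreover from this have "a = b"
        using chart_inv[OF U, of a] chart_inv[OF U, of b] by simp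
      ultimately show "z \<in> \<phi> ` (U \<inter> (W \<inter> V))" by blast
    qed
    then have "smooth_on (\<phi> ` (U \<inter> W) \<inter> \<phi> ` (U \<inter> V)) (\<lambda>x. f (inv_into U \<phi> x))"
      by (rule smooth_on_subset[OF smooth_funD[OF V(3) U]])
    then show "\<exists>V. open V \<and> x \<in> V \<and> smooth_on (\<phi> ` (U \<inter> W) \<inter> V) (\<lambda>x. f (inv_into U \<phi> x))"
      using chart_image_Int_open[OF U V(1)] p V(2) by (intro exI[of _ "\<phi> ` (U \<inter> V)"]) auto
  qed (rule chart_image_Int_open[OF U \<open>open W\<close>])
qed

text \<open>\<open>W\<close> is covered by \<open>U\<close>, where the extension is a product of
  smooth functions, and by the complement of \<open>K\<close>, where it is 0. Vanishing outside a
  closed \<open>K\<close> inside \<open>U\<close>, and not just outside \<open>U\<close>, makes the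
  second set open.\<close>

lemma smooth_fun_extend:
  assumes "open U" "open W" "closed K" "K \<subseteq> U" "\<eta> \<in> Cinf A" "\<And>p. p \<notin> K \<Longrightarrow> \<eta> p = 0"
    and f: "smooth_fun A (U \<inter> W) f"
  shows "smooth_fun A W (\<lambda>p. if p \<in> U then \<eta> p * f p else 0)"
proof (rule smooth_fun_local[OF \<open>open W\<close>])
  fix p assume "p \<in> W"
  let ?F = "\<lambda>p. if p \<in> U then \<eta> p * f p else 0"
  have "smooth_fun A (U \<inter> W) (\<lambda>p. \<eta> p * f p)"
    using assms(5) by (intro smooth_fun_mult[OF _ _ f] open_Int assms(1,2))
      (auto simp: Cinf_def intro: smooth_fun_subset[of UNIV])
  then have 1: "smooth_fun A (W \<inter> U) ?F"
    unfolding Int_commute[of W U]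
    by (rule smooth_fun_cong[rotated 2]) (use assms(1,2) in \<open>auto intro: open_Int\<close>)
  have "open (W \<inter> - K)" using assms(2,3) by (intro open_Int) auto
  then have 2: "smooth_fun A (W \<inter> - K) ?F"
    by (rule smooth_fun_cong[OF _ _ smooth_fun_const[of _ 0]]) (use assms(6) \<open>open (W \<inter> - K)\<close> in auto)
  show "\<exists>V. open V \<and> p \<in> V \<and> smooth_fun A (W \<inter> V) ?F"
  proof (cases "p \<in> U")
    case True
    then show ?thesis using 1 assms(1) by blast
  next
    case False
    then show ?thesis using 2 assms(3,4) by (intro exI[of _ "- K"]) auto
  qed
qed

text \<open>A smooth step function is applied to r^2 minus the squared chart distance from p. The
  result is 1 near p and is supported in the chart preimage \<open>K\<close> of a closed
  ball.\<close>

lemma bump_function: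
  assumes "open O'" "p \<in> O'"
  obtains \<eta> K W where "\<eta> \<in> Cinf A" "closed K" "K \<subseteq> O'" "\<And>q. q \<notin> K \<Longrightarrow> \<eta> q = 0"
    "open W" "p \<in> W" "W \<subseteq> O'" "\<And>q. q \<in> W \<Longrightarrow> \<eta> q = 1"
proof -
  obtain U \<phi> where U: "(U, \<phi>) \<in> A" and p: "p \<in> U" using chart_cover by blast
  define y where "y = \<phi> p"
  have "y \<in> \<phi> ` (U \<inter> O')" using p assms by (auto simp: y_def)
  then obtain r where r: "r > 0" "cball y r \<subseteq> \<phi> ` (U \<inter> O')"
    using chart_image_Int_open[OF U assms(1)] open_contains_cball by blast
  define K where "K = inv_into U \<phi> ` cball y r"
  obtain B :: "'n set" where "finite B" "span B = UNIV"
    using atlas[unfolded smooth_atlas_def, THEN conjunct1] by auto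
  then have "compact (cball y r)" by (rule compact_cball_finite_span)
  moreover have "continuous_on (cball y r) (inv_into U \<phi>)"
    by (rule continuous_on_subset[OF chart_continuous(2)[OF U]]) (use r(2) in auto)
  ultimately have "compact K"
    unfolding K_def by (intro compact_continuous_image)
  \<comment> \<open>The preimage of a closed ball is a priori closed only in the chart domain;
    closedness in the whole manifold comes from compactness and the Hausdorff property.\<close>
  then have K: "closed K" by (rule compact_imp_closed)
  have KO: "K \<subseteq> U \<inter> O'"
    using r(2) chart_inv[OF U] unfolding K_def by fastforce
  have inK: "q \<in> K" if "q \<in> U" "\<phi> q \<in> cball y r" for q
    using that chart_inv[OF U] unfolding K_def by (metis image_eqI)
  \<comment> \<open>On the ball of half the radius, r^2 minus the squared distance is at least 3 r^2
    / 4, hence above the threshold r^2 / 2 from which the step equals 1.\<close>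
  obtain \<sigma> :: "real \<Rightarrow> real" where \<sigma>: "smooth_on UNIV \<sigma>" "\<And>t. t \<le> 0 \<Longrightarrow> \<sigma> t = 0"
    "\<And>t. t \<ge> r\<^sup>2 / 2 \<Longrightarrow> \<sigma> t = 1"
    by (rule smooth_step_exists[of "r\<^sup>2 / 2"]) (use r(1) in auto)
  \<comment> \<open>The squared distance, unlike the distance, is smooth at the centre.\<close>
  define \<eta> where "\<eta> q = (if q \<in> U then \<sigma> (r\<^sup>2 - inner (\<phi> q - y) (\<phi> q - y)) else 0)" for q
  have zero: "\<eta> q = 0" if "q \<notin> K" for q
  proof (cases "q \<in> U")
    case True
    then have "\<not> norm (\<phi> q - y) \<le> r"
      using that inK[OF True] by (auto simp: dist_norm norm_minus_commute)
    then have "r \<le> norm (\<phi> q - y)"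
      by linarith
    then have "r\<^sup>2 \<le> inner (\<phi> q - y) (\<phi> q - y)"
      using r(1) by (metis dot_square_norm less_imp_le power_mono)
    then show ?thesis using \<sigma>(2) by (simp add: \<eta>_def)
  qed (simp add: \<eta>_def)
  have "smooth_fun A UNIV \<eta>"
  proof (rule smooth_fun_local)
    have 1: "smooth_fun A U \<eta>"
    proof (rule smooth_funI)
      fix V \<psi> assume V: "(V, \<psi>) \<in> A"
      let ?\<tau> = "\<phi> \<circ> inv_into V \<psi>" and ?S = "\<psi> ` (V \<inter> U)"
      have o: "open ?S" by (rule chart_image_Int_open[OF V chart_open[OF U]])
      have \<tau>: "smooth_on ?S (\<lambda>x. ?\<tau> x - y)"
        by (intro smooth_on_diff o chart_transition V U smooth_on_const)
      have "smooth_on ?S (\<lambda>x. \<sigma> (r\<^sup>2 - inner (?\<tau> x - y) (?\<tau> x - y)))"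
        by (rule smooth_on_compose_real[OF o \<sigma>(1) smooth_on_diff[OF o smooth_on_const[OF o]
                smooth_on_bilinear[OF bounded_bilinear_inner o \<tau> \<tau>]]])
      moreover have "\<sigma> (r\<^sup>2 - inner (?\<tau> x - y) (?\<tau> x - y)) = \<eta> (inv_into V \<psi> x)" if "x \<in> ?S" for x
        using that chart_inv[OF V] by (auto simp: \<eta>_def)
      ultimately show "smooth_on ?S (\<lambda>x. \<eta> (inv_into V \<psi> x))"
        using smooth_on_cong[OF o, of "\<lambda>x. \<sigma> (r\<^sup>2 - inner (?\<tau> x - y) (?\<tau> x - y))"
            "\<lambda>x. \<eta> (inv_into V \<psi> x)"] by simp
    qed
    have 2: "smooth_fun A (- K) \<eta>"
      by (rule smooth_fun_cong[OF _ _ smooth_fun_const[of _ 0]]) (use K zero open_Compl in auto)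
    show "\<exists>V. open V \<and> q \<in> V \<and> smooth_fun A (UNIV \<inter> V) \<eta>" for q
    proof (cases "q \<in> U")
      case True
      then show ?thesis using 1 chart_open[OF U] by auto
    next
      case False
      then show ?thesis using 2 K KO by (intro exI[of _ "- K"]) auto
    qed
  qed simp
  then have "\<eta> \<in> Cinf A" by (simp add: Cinf_def)
  moreover define W where "W = U \<inter> \<phi> -` ball y (r / 2)"
  have "open W"
    unfolding W_def by (rule continuous_open_preimage[OF chart_continuous(1)[OF U] chart_open[OF U]]) simp
  moreover have "p \<in> W" using p r(1) by (simp add: W_def y_def)
  moreover have "W \<subseteq> O'"
    using inK KO r(1) by (force simp: W_def)
  moreover have "\<eta> q = 1" if "q \<in> W" for q
  proof -
    have q: "q \<in> U" "norm (\<phi> q - y) \<le> r / 2"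
      using that by (auto simp: W_def dist_norm norm_minus_commute)
    then have "inner (\<phi> q - y) (\<phi> q - y) \<le> (r / 2)\<^sup>2"
      by (metis dot_square_norm norm_ge_zero power_mono)
    moreover have "(r / 2)\<^sup>2 \<le> r\<^sup>2 / 2"
      by (simp add: power2_eq_square)
    ultimately show ?thesis
      using q(1) \<sigma>(3) by (simp add: \<eta>_def)
  qed
  ultimately show ?thesis
    using K KO zero by (intro that[of \<eta> K W]) auto
qed

section \<open>The algebra of smooth functions\<close>

lemma Cinf_const: "(\<lambda>p. c) \<in> Cinf A"
  by (simp add: Cinf_def smooth_fun_const)

lemma Cinf_add: "f \<in> Cinf A \<Longrightarrow> h \<in> Cinf A \<Longrightarrow> f + h \<in> Cinf A"
  by (simp add: Cinf_def smooth_fun_add plus_fun_def)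

lemma Cinf_mult: "f \<in> Cinf A \<Longrightarrow> h \<in> Cinf A \<Longrightarrow> f * h \<in> Cinf A"
  by (simp add: Cinf_def smooth_fun_mult times_fun_def)

lemma Cinf_diff: "f \<in> Cinf A \<Longrightarrow> h \<in> Cinf A \<Longrightarrow> f - h \<in> Cinf A"
  by (simp add: Cinf_def smooth_fun_diff fun_diff_def)

lemma Cinf_smooth_fun: "f \<in> Cinf A \<Longrightarrow> smooth_fun A W f"
  by (auto simp: Cinf_def intro: smooth_fun_subset)

end


section \<open>Bases and coordinates\<close>

text \<open>\<open>representation\<close> attaches coefficients to vectors, whereas frames are
  indexed families. Injectivity of the family, part of \<open>is_basis\<close>, transports the
  coefficients \<open>c\<close> from indices to basis vectors.\<close>

lemma coframe_sum:
  assumes "is_basis V k (\<lambda>i. X i p)" "i < k"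
  shows "coframe k X i p (\<Sum>j<k. c j *\<^sub>R X j p) = c i"
proof -
  let ?b = "\<lambda>j. X j p"
  have b: "inj_on ?b {..<k}" "independent (?b ` {..<k})"
    using assms(1) by (auto simp: is_basis_def)
  have inv: "inv_into {..<k} ?b (X i p) = i" if "i < k" for i
    using inv_into_f_f[OF b(1), of i] that by simp
  let ?c = "\<lambda>v. if v \<in> ?b ` {..<k} then c (inv_into {..<k} ?b v) else 0"
  have s: "(\<Sum>j<k. c j *\<^sub>R X j p) = (\<Sum>v\<in>?b ` {..<k}. ?c v *\<^sub>R v)"
    using b(1) by (subst sum.reindex) (auto intro!: sum.cong simp: inv)
  have "representation (?b ` {..<k}) (\<Sum>v\<in>?b ` {..<k}. ?c v *\<^sub>R v) = ?c"
  proof (rule representation_eqI[OF b(2)])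
    have fs: "{v. ?c v \<noteq> 0} \<subseteq> ?b ` {..<k}" by auto
    show "finite {v. ?c v \<noteq> 0}" by (rule finite_subset[OF fs]) simp
    show "(\<Sum>v | ?c v \<noteq> 0. ?c v *\<^sub>R v) = (\<Sum>v\<in>?b ` {..<k}. ?c v *\<^sub>R v)"
      by (rule sum.mono_neutral_left[OF _ fs]) auto
    show "(\<Sum>v\<in>?b ` {..<k}. ?c v *\<^sub>R v) \<in> span (?b ` {..<k})"
      by (rule span_sum, rule span_scale, rule span_base)
  qed (auto split: if_splits)
  then show ?thesis
    using assms(2) b(1) by (simp add: coframe_def s inv)
qed

lemma is_basis_expansion:
  assumes "is_basis V k b" "v \<in> V"
  obtains c where "v = (\<Sum>j<k. c j *\<^sub>R b j)"
proof -
  have "v \<in> span (b ` {..<k})" using assms by (simp add: is_basis_def)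
  then obtain u where "v = (\<Sum>w\<in>b ` {..<k}. u w *\<^sub>R w)"
    using span_finite[of "b ` {..<k}"] by auto
  then have "v = (\<Sum>j<k. u (b j) *\<^sub>R b j)"
    using assms(1) by (simp add: is_basis_def sum.reindex)
  then show ?thesis by (rule that)
qed

lemma is_basis_combination_mem:
  "is_basis V k b \<Longrightarrow> (\<Sum>j<k. c j *\<^sub>R b j) \<in> V"
  by (auto simp: is_basis_def intro: span_sum span_scale span_base)

lemma is_basis_mem: "is_basis V k b \<Longrightarrow> j < k \<Longrightarrow> b j \<in> V"
  by (auto simp: is_basis_def intro: span_base)

lemma coframe_expansion:
  assumes "is_basis V k (\<lambda>i. X i p)" "v \<in> V"
  shows "(\<Sum>j<k. coframe k X j p v *\<^sub>R X j p) = v"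
proof -
  obtain c where c: "v = (\<Sum>j<k. c j *\<^sub>R X j p)"
    using is_basis_expansion[OF assms] .
  then have "coframe k X j p v = c j" if "j < k" for j
    using coframe_sum[of V k X p j c] assms(1) that by simp
  then show ?thesis using c by simp
qed

lemma coframe_linear:
  assumes "is_basis V k (\<lambda>i. X i p)" "i < k"
  shows "linear_on_set V (coframe k X i p)"
proof -
  have b: "independent ((\<lambda>j. X j p) ` {..<k})" "span ((\<lambda>j. X j p) ` {..<k}) = V"
    using assms(1) by (auto simp: is_basis_def)
  show ?thesis
    unfolding linear_on_set_def coframe_def
    using representation_add[OF b(1)] representation_scale[OF b(1)] b(2) by simp
qed

text \<open>\<open>representation\<close> is 0 outside the span by definition, which agrees with the
  normalisation of the dual fibres.\<close>

lemma coframe_outside: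
  assumes "is_basis V k (\<lambda>i. X i p)" "v \<notin> V"
  shows "coframe k X i p v = 0"
  using assms by (simp add: coframe_def representation_def is_basis_def)

lemma coframe_delta:
  assumes "is_basis V k (\<lambda>i. X i p)" "i < k" "j < k"
  shows "coframe k X i p (X j p) = (if i = j then 1 else 0)"
proof -
  have "X j p = (\<Sum>l<k. (if l = j then 1 else 0) *\<^sub>R X l p)"
    using assms(3) by (simp add: if_distrib[of "\<lambda>c. c *\<^sub>R _"] cong: if_cong)
  then show ?thesis
    using coframe_sum[of V k X p i "\<lambda>l. if l = j then 1 else 0"] assms(1,2) by simp
qed

lemma linear_on_set_sum:
  assumes "linear_on_set V h" "subspace V" "\<And>i. i \<in> I \<Longrightarrow> b i \<in> V"
  shows "h (\<Sum>i\<in>I. c i *\<^sub>R b i) = (\<Sum>i\<in>I. c i *\<^sub>R h (b i))"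
proof -
  have h0: "h 0 = 0"
    using assms(1) subspace_0[OF assms(2)] unfolding linear_on_set_def by (metis scaleR_zero_left)
  show ?thesis
    using assms(3)
  proof (induction I rule: infinite_finite_induct)
    case (insert a F)
    have "(\<Sum>i\<in>F. c i *\<^sub>R b i) \<in> V" "c a *\<^sub>R b a \<in> V"
      using insert.prems by (auto intro: subspace_sum subspace_scale assms(2))
    then show ?case
      using insert assms(1) by (simp add: linear_on_set_def)
  qed (use h0 in auto)
qed


lemma is_basisI:
  assumes "subspace V" "\<And>i. i < k \<Longrightarrow> b i \<in> V"
    and span: "\<And>v. v \<in> V \<Longrightarrow> \<exists>c. v = (\<Sum>i<k. c i *\<^sub>R b i)"
    and indep: "\<And>c i. (\<Sum>j<k. c j *\<^sub>R b j) = 0 \<Longrightarrow> i < k \<Longrightarrow> c i = 0"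
  shows "is_basis V k b"
proof -
  have inj: "inj_on b {..<k}"
  proof (rule inj_onI, rule ccontr)
    fix i j assume ij: "i \<in> {..<k}" "j \<in> {..<k}" "b i = b j" "i \<noteq> j"
    \<comment> \<open>If two members coincide, the difference of the two unit coefficient vectors
      gives a vanishing combination with a nonzero coefficient.\<close>
    let ?c = "\<lambda>l. (if l = i then 1 else 0) - (if l = j then 1 else 0 :: real)"
    have "(\<Sum>l<k. ?c l *\<^sub>R b l) =
        (\<Sum>l<k. if l = i then b l else 0) - (\<Sum>l<k. if l = j then b l else 0)"
      by (simp add: scaleR_left_diff_distrib sum_subtractf if_distrib[of "\<lambda>c. c *\<^sub>R _"] cong: if_cong)
    also have "\<dots> = 0" using ij by simp
    finally have "?c i = 0" using indep[of ?c i] ij(1) by simp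
    then show False using ij(4) by simp
  qed
  moreover have "independent (b ` {..<k})"
  proof (rule independent_if_scalars_zero)
    fix f x assume "(\<Sum>x\<in>b ` {..<k}. f x *\<^sub>R x) = 0" and x: "x \<in> b ` {..<k}"
    then have "(\<Sum>j<k. f (b j) *\<^sub>R b j) = 0"
      using inj by (simp add: sum.reindex)
    then show "f x = 0" using indep[of "\<lambda>j. f (b j)"] x by auto
  qed simp
  moreover have "span (b ` {..<k}) = V"
  proof
    show "span (b ` {..<k}) \<subseteq> V"
      using assms(1,2) by (intro span_minimal) auto
    show "V \<subseteq> span (b ` {..<k})"
    proof
      fix v assume "v \<in> V"
      then obtain c where c: "v = (\<Sum>i<k. c i *\<^sub>R b i)" using span by meson
      show "v \<in> span (b ` {..<k})"
        unfolding c by (rule span_sum, rule span_scale, rule span_base) auto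
    qed
  qed
  ultimately show ?thesis by (simp add: is_basis_def)
qed


section \<open>Sections of vector bundles\<close>

lemma smooth_section_onI:
  assumes "\<And>p. p \<in> W \<Longrightarrow> s p \<in> fibre E p"
    and "\<And>U X. (U, X) \<in> frames E \<Longrightarrow> \<exists>c. (\<forall>i<rank E. smooth_fun A (U \<inter> W) (c i)) \<and>
        (\<forall>p\<in>U \<inter> W. s p = (\<Sum>i<rank E. c i p *\<^sub>R X i p))"
  shows "smooth_section_on A E W s"
  using assms unfolding smooth_section_on_def by (auto split: prod.splits)

lemma smooth_section_on_fibre:
  "smooth_section_on A E W s \<Longrightarrow> p \<in> W \<Longrightarrow> s p \<in> fibre E p"
  by (simp add: smooth_section_on_def)

lemma smooth_section_on_coefficients:
  assumes "smooth_section_on A E W s" "(U, X) \<in> frames E"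
  obtains c where "\<forall>i<rank E. smooth_fun A (U \<inter> W) (c i)"
    "\<forall>p\<in>U \<inter> W. s p = (\<Sum>i<rank E. c i p *\<^sub>R X i p)"
proof -
  have "\<exists>c. (\<forall>i<rank E. smooth_fun A (U \<inter> W) (c i)) \<and>
        (\<forall>p\<in>U \<inter> W. s p = (\<Sum>i<rank E. c i p *\<^sub>R X i p))"
    using bspec[OF conjunct2[OF assms(1)[unfolded smooth_section_on_def]] assms(2)] by simp
  then show ?thesis using that by auto
qed

lemma sections_iff: "s \<in> sections A E \<longleftrightarrow> smooth_section_on A E UNIV s"
  by (simp add: sections_def)

lemma sections_fibre: "s \<in> sections A E \<Longrightarrow> s p \<in> fibre E p"
  using smooth_section_on_fibre[of A E UNIV s p] by (simp add: sections_iff)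

locale smooth_bundle = smooth_manifold A
  for A :: "('m::{t2_space,second_countable_topology}, 'n::real_inner) chart set" +
  fixes E :: "('m, 'f::real_vector) vbundle"
  assumes vb: "vector_bundle A E"
begin

lemma fibre_subspace: "subspace (fibre E p)"
  using vb by (simp add: vector_bundle_def)

lemma frame_cover: "\<exists>U X. (U, X) \<in> frames E \<and> p \<in> U"
proof -
  have "p \<in> (\<Union>(U, X)\<in>frames E. U)"
    using vb by (simp add: vector_bundle_def)
  then show ?thesis by auto
qed

lemma
  assumes "(U, X) \<in> frames E"
  shows frame_open: "open U"
    and frame_basis: "\<And>p. p \<in> U \<Longrightarrow> is_basis (fibre E p) (rank E) (\<lambda>i. X i p)"
    and frame_section: "\<And>i. i < rank E \<Longrightarrow> smooth_section_on A E U (X i)"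
  using vb[unfolded vector_bundle_def, THEN conjunct2, THEN conjunct2] assms
  by (auto dest!: bspec)

lemma section_on_coordinate:
  assumes "smooth_section_on A E W s" "open W" "(U, X) \<in> frames E" "i < rank E"
  shows "smooth_fun A (U \<inter> W) (\<lambda>p. coframe (rank E) X i p (s p))"
proof -
  obtain c where c: "\<And>i. i < rank E \<Longrightarrow> smooth_fun A (U \<inter> W) (c i)"
    "\<And>p. p \<in> U \<Longrightarrow> p \<in> W \<Longrightarrow> s p = (\<Sum>i<rank E. c i p *\<^sub>R X i p)"
    by (rule smooth_section_on_coefficients[OF assms(1,3)]) (rule that; simp)
  have "c i p = coframe (rank E) X i p (s p)" if p: "p \<in> U \<inter> W" for p
    using coframe_sum[of "fibre E p" "rank E" X p i "\<lambda>i. c i p"] frame_basis[OF assms(3)] assms(4) p c(2)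
    by simp
  then show ?thesis
    using smooth_fun_cong[OF open_Int[OF frame_open[OF assms(3)] assms(2)] _ c(1)[OF assms(4)]] by simp
qed

text \<open>The coefficients in the definition of a smooth section are only asserted to exist. On a
  basis they must be the coframe values, and with these canonical coefficients smoothness becomes a
  local property that needs no choices to be glued.\<close>

lemma section_on_iff_coordinates:
  assumes "open W"
  shows "smooth_section_on A E W s \<longleftrightarrow> (\<forall>p\<in>W. s p \<in> fibre E p) \<and>
    (\<forall>U X. (U, X) \<in> frames E \<longrightarrow> (\<forall>i<rank E. smooth_fun A (U \<inter> W) (\<lambda>p. coframe (rank E) X i p (s p))))"
proof (intro iffI conjI ballI allI impI)
  assume R: "(\<forall>p\<in>W. s p \<in> fibre E p) \<and>
    (\<forall>U X. (U, X) \<in> frames E \<longrightarrow> (\<forall>i<rank E. smooth_fun A (U \<inter> W) (\<lambda>p. coframe (rank E) X i p (s p))))"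
  show "smooth_section_on A E W s"
  proof (rule smooth_section_onI)
    fix U X assume U: "(U, X) \<in> frames E"
    have "s p = (\<Sum>i<rank E. coframe (rank E) X i p (s p) *\<^sub>R X i p)" if "p \<in> U \<inter> W" for p
      using coframe_expansion[of "fibre E p" "rank E" X p "s p"] frame_basis[OF U] that R by simp
    then show "\<exists>c. (\<forall>i<rank E. smooth_fun A (U \<inter> W) (c i)) \<and>
        (\<forall>p\<in>U \<inter> W. s p = (\<Sum>i<rank E. c i p *\<^sub>R X i p))"
      using R U by (intro exI[of _ "\<lambda>i p. coframe (rank E) X i p (s p)"]) auto
  qed (use R in auto)
qed (use smooth_section_on_fibre section_on_coordinate assms in auto)

lemma section_on_local:
  assumes "open W" "\<And>p. p \<in> W \<Longrightarrow> \<exists>V. open V \<and> p \<in> V \<and> smooth_section_on A E V s"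
  shows "smooth_section_on A E W s"
  unfolding section_on_iff_coordinates[OF \<open>open W\<close>]
proof (intro conjI ballI allI impI)
  show "s p \<in> fibre E p" if "p \<in> W" for p
    using assms(2)[OF that] smooth_section_on_fibre by auto
  fix U X i assume U: "(U, X) \<in> frames E" and i: "i < rank E"
  show "smooth_fun A (U \<inter> W) (\<lambda>p. coframe (rank E) X i p (s p))"
  proof (rule smooth_fun_local)
    fix p assume "p \<in> U \<inter> W"
    then obtain V where V: "open V" "p \<in> V" "smooth_section_on A E V s"
      using assms(2) by auto
    have "smooth_fun A (U \<inter> W \<inter> V) (\<lambda>p. coframe (rank E) X i p (s p))"
      by (rule smooth_fun_subset[OF section_on_coordinate[OF V(3,1) U i]]) auto
    then show "\<exists>V. open V \<and> p \<in> V \<and> smooth_fun A (U \<inter> W \<inter> V) (\<lambda>p. coframe (rank E) X i p (s p))"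
      using V by auto
  qed (use frame_open[OF U] assms(1) in auto)
qed

lemma section_on_cong:
  assumes "smooth_section_on A E W s" "open W" "\<And>p. p \<in> W \<Longrightarrow> s p = t p"
  shows "smooth_section_on A E W t"
proof (rule smooth_section_onI)
  show "t p \<in> fibre E p" if "p \<in> W" for p
    using assms(3)[OF that] smooth_section_on_fibre[OF assms(1) that] by simp
  fix U X assume U: "(U, X) \<in> frames E"
  show "\<exists>c. (\<forall>i<rank E. smooth_fun A (U \<inter> W) (c i)) \<and>
        (\<forall>p\<in>U \<inter> W. t p = (\<Sum>i<rank E. c i p *\<^sub>R X i p))"
    by (rule smooth_section_on_coefficients[OF assms(1) U]) (use assms(3) in auto)
qed

lemma section_on_subset:
  assumes "smooth_section_on A E W s" "V \<subseteq> W"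
  shows "smooth_section_on A E V s"
proof (rule smooth_section_onI)
  show "s p \<in> fibre E p" if "p \<in> V" for p
    using smooth_section_on_fibre[OF assms(1)] that assms(2) by auto
  fix U X assume U: "(U, X) \<in> frames E"
  obtain c where c: "\<And>i. i < rank E \<Longrightarrow> smooth_fun A (U \<inter> W) (c i)"
    "\<And>p. p \<in> U \<Longrightarrow> p \<in> W \<Longrightarrow> s p = (\<Sum>i<rank E. c i p *\<^sub>R X i p)"
    by (rule smooth_section_on_coefficients[OF assms(1) U]) (rule that; simp)
  have "smooth_fun A (U \<inter> V) (c i)" if "i < rank E" for i
    by (rule smooth_fun_subset[OF c(1)[OF that]]) (use assms(2) in auto)
  then show "\<exists>c. (\<forall>i<rank E. smooth_fun A (U \<inter> V) (c i)) \<and>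
        (\<forall>p\<in>U \<inter> V. s p = (\<Sum>i<rank E. c i p *\<^sub>R X i p))"
    using c(2) assms(2) by (intro exI[of _ c]) auto
qed

lemma section_on_zero:
  assumes "open W"
  shows "smooth_section_on A E W (\<lambda>p. 0)"
proof (rule smooth_section_onI)
  fix U X assume "(U, X) \<in> frames E"
  then show "\<exists>c. (\<forall>i<rank E. smooth_fun A (U \<inter> W) (c i)) \<and>
        (\<forall>p\<in>U \<inter> W. 0 = (\<Sum>i<rank E. c i p *\<^sub>R X i p))"
    using assms frame_open by (intro exI[of _ "\<lambda>i p. 0"]) (auto intro: smooth_fun_const)
qed (rule subspace_0[OF fibre_subspace])

lemma section_on_add:
  assumes "open W" "smooth_section_on A E W s" "smooth_section_on A E W t"
  shows "smooth_section_on A E W (\<lambda>p. s p + t p)"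
proof (rule smooth_section_onI)
  show "s p + t p \<in> fibre E p" if "p \<in> W" for p
    using that assms by (auto intro: subspace_add[OF fibre_subspace] smooth_section_on_fibre)
  fix U X assume U: "(U, X) \<in> frames E"
  obtain c where c: "\<And>i. i < rank E \<Longrightarrow> smooth_fun A (U \<inter> W) (c i)"
    "\<And>p. p \<in> U \<Longrightarrow> p \<in> W \<Longrightarrow> s p = (\<Sum>i<rank E. c i p *\<^sub>R X i p)"
    by (rule smooth_section_on_coefficients[OF assms(2) U]) (rule that; simp)
  obtain d where d: "\<And>i. i < rank E \<Longrightarrow> smooth_fun A (U \<inter> W) (d i)"
    "\<And>p. p \<in> U \<Longrightarrow> p \<in> W \<Longrightarrow> t p = (\<Sum>i<rank E. d i p *\<^sub>R X i p)"
    by (rule smooth_section_on_coefficients[OF assms(3) U]) (rule that; simp)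
  show "\<exists>c. (\<forall>i<rank E. smooth_fun A (U \<inter> W) (c i)) \<and>
        (\<forall>p\<in>U \<inter> W. s p + t p = (\<Sum>i<rank E. c i p *\<^sub>R X i p))"
    using c d open_Int[OF frame_open[OF U] assms(1)]
    by (intro exI[of _ "\<lambda>i p. c i p + d i p"])
      (auto intro: smooth_fun_add simp: scaleR_add_left sum.distrib)
qed

lemma section_on_scale:
  assumes "open W" "smooth_fun A W f" "smooth_section_on A E W s"
  shows "smooth_section_on A E W (\<lambda>p. f p *\<^sub>R s p)"
proof (rule smooth_section_onI)
  show "f p *\<^sub>R s p \<in> fibre E p" if "p \<in> W" for p
    using that assms by (auto intro: subspace_scale[OF fibre_subspace] smooth_section_on_fibre)
  fix U X assume U: "(U, X) \<in> frames E"
  obtain c where c: "\<And>i. i < rank E \<Longrightarrow> smooth_fun A (U \<inter> W) (c i)"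
    "\<And>p. p \<in> U \<Longrightarrow> p \<in> W \<Longrightarrow> s p = (\<Sum>i<rank E. c i p *\<^sub>R X i p)"
    by (rule smooth_section_on_coefficients[OF assms(3) U]) (rule that; simp)
  have "smooth_fun A (U \<inter> W) f"
    by (rule smooth_fun_subset[OF assms(2)]) auto
  then show "\<exists>c. (\<forall>i<rank E. smooth_fun A (U \<inter> W) (c i)) \<and>
        (\<forall>p\<in>U \<inter> W. f p *\<^sub>R s p = (\<Sum>i<rank E. c i p *\<^sub>R X i p))"
    using c open_Int[OF frame_open[OF U] assms(1)]
    by (intro exI[of _ "\<lambda>i p. f p * c i p"])
      (auto intro: smooth_fun_mult simp: scaleR_sum_right)
qed

lemma section_on_sum:
  assumes "open W" "\<And>i. i \<in> I \<Longrightarrow> smooth_section_on A E W (s i)"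
  shows "smooth_section_on A E W (\<lambda>p. \<Sum>i\<in>I. s i p)"
  using assms(2)
  by (induction I rule: infinite_finite_induct)
    (auto intro: section_on_zero[OF assms(1)] section_on_add[OF assms(1)])

lemma section_extend:
  assumes "open U" "closed K" "K \<subseteq> U" "\<eta> \<in> Cinf A" "\<And>p. p \<notin> K \<Longrightarrow> \<eta> p = 0"
    and s: "smooth_section_on A E U s"
  shows "(\<lambda>p. if p \<in> U then \<eta> p *\<^sub>R s p else 0) \<in> sections A E"
  unfolding sections_iff
proof (rule smooth_section_onI)
  show "(if p \<in> U then \<eta> p *\<^sub>R s p else 0) \<in> fibre E p" for p
    using smooth_section_on_fibre[OF s] subspace_scale[OF fibre_subspace] subspace_0[OF fibre_subspace]
    by auto
  fix V X assume V: "(V, X) \<in> frames E"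
  obtain c where c: "\<And>i. i < rank E \<Longrightarrow> smooth_fun A (V \<inter> U) (c i)"
    "\<And>p. p \<in> V \<Longrightarrow> p \<in> U \<Longrightarrow> s p = (\<Sum>i<rank E. c i p *\<^sub>R X i p)"
    by (rule smooth_section_on_coefficients[OF s V]) (rule that; simp)
  have "smooth_fun A V (\<lambda>p. if p \<in> U then \<eta> p * c i p else 0)" if "i < rank E" for i
    by (rule smooth_fun_extend[OF assms(1) frame_open[OF V] assms(2-5)])
      (use c(1)[OF that] in \<open>simp_all add: Int_commute\<close>)
  then show "\<exists>c. (\<forall>i<rank E. smooth_fun A (V \<inter> UNIV) (c i)) \<and>
        (\<forall>p\<in>V \<inter> UNIV. (if p \<in> U then \<eta> p *\<^sub>R s p else 0) = (\<Sum>i<rank E. c i p *\<^sub>R X i p))"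
    using c(2) by (intro exI[of _ "\<lambda>i p. if p \<in> U then \<eta> p * c i p else 0"]) (auto simp: scaleR_sum_right)
qed

text \<open>A combination of frame sections with constant coefficients, cut off by a bump function.
  Through it, conditions on fibre vectors can be tested against global sections.\<close>

lemma section_through:
  assumes "v \<in> fibre E p"
  obtains s where "s \<in> sections A E" "s p = v"
proof -
  obtain U X where U: "(U, X) \<in> frames E" "p \<in> U" using frame_cover[of p] by auto
  obtain c where c: "v = (\<Sum>j<rank E. c j *\<^sub>R X j p)"
    using is_basis_expansion[OF frame_basis[OF U] assms] .
  have o: "open U" by (rule frame_open[OF U(1)])
  have s: "smooth_section_on A E U (\<lambda>q. \<Sum>j<rank E. c j *\<^sub>R X j q)"
    by (rule section_on_sum[OF o], rule section_on_scale[OF o smooth_fun_const[OF o]],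
        rule frame_section[OF U(1)]) simp
  obtain \<eta> K W where \<eta>: "\<eta> \<in> Cinf A" "closed K" "K \<subseteq> U" "\<And>q. q \<notin> K \<Longrightarrow> \<eta> q = 0"
    "p \<in> W" "\<And>q. q \<in> W \<Longrightarrow> \<eta> q = 1"
    by (rule bump_function[OF o U(2)]) blast
  show ?thesis
    by (rule that[OF section_extend[OF o \<eta>(2,3,1,4) s]]) (use U(2) \<eta>(5,6) c in auto)
qed

section \<open>The module of global sections over the smooth functions\<close>

lemma sections_zero: "0 \<in> sections A E"
  using section_on_zero[of UNIV] by (simp add: sections_iff zero_fun_def)

lemma sections_add: "s \<in> sections A E \<Longrightarrow> t \<in> sections A E \<Longrightarrow> s + t \<in> sections A E"
  using section_on_add[of UNIV s t] by (simp add: sections_iff plus_fun_def)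

lemma sections_fmult: "f \<in> Cinf A \<Longrightarrow> s \<in> sections A E \<Longrightarrow> f *\<^sub>F s \<in> sections A E"
  using section_on_scale[of UNIV f s] by (simp add: sections_iff fmult_def Cinf_def)

lemma sections_scale: "s \<in> sections A E \<Longrightarrow> c *\<^sub>R s \<in> sections A E"
  using sections_fmult[OF Cinf_const[of c]] by (simp add: fmult_def scaleR_fun_def)

lemma sections_uminus: "s \<in> sections A E \<Longrightarrow> - s \<in> sections A E"
  using sections_scale[of s "-1"] by simp

lemma sections_diff: "s \<in> sections A E \<Longrightarrow> t \<in> sections A E \<Longrightarrow> s - t \<in> sections A E"
  using sections_add[OF _ sections_uminus, of s t] by simp

lemma sections_combination:
  assumes "\<And>i. i \<in> I \<Longrightarrow> f i \<in> Cinf A" "\<And>i. i \<in> I \<Longrightarrow> s i \<in> sections A E"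
  shows "(\<lambda>q. \<Sum>i\<in>I. f i q *\<^sub>R s i q) \<in> sections A E"
  unfolding sections_iff
  by (rule section_on_sum[OF open_UNIV], rule section_on_scale[OF open_UNIV])
    (use assms in \<open>auto simp: sections_iff Cinf_def\<close>)

lemma Cinf_linear_combination:
  assumes "Cinf_linear_on A (sections A E) H"
    and "\<And>i. i \<in> I \<Longrightarrow> f i \<in> Cinf A" "\<And>i. i \<in> I \<Longrightarrow> s i \<in> sections A E"
  shows "H (\<lambda>q. \<Sum>i\<in>I. f i q *\<^sub>R s i q) = (\<lambda>q. \<Sum>i\<in>I. f i q *\<^sub>R H (s i) q)"
proof -
  have "H ((\<lambda>q. 0) *\<^sub>F 0) = (\<lambda>q. 0) *\<^sub>F H 0"
    using assms(1) sections_zero Cinf_const[of 0] by (simp add: Cinf_linear_on_def)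
  then have H0: "H (\<lambda>q. 0) = (\<lambda>q. 0)"
    by (simp add: fmult_def)
  show ?thesis
    using assms(2,3)
  proof (induction I rule: infinite_finite_induct)
    case (insert a I)
    have 1: "(\<lambda>q. \<Sum>i\<in>insert a I. f i q *\<^sub>R s i q) = f a *\<^sub>F s a + (\<lambda>q. \<Sum>i\<in>I. f i q *\<^sub>R s i q)"
      using insert.hyps by (simp add: fmult_def plus_fun_def)
    have 2: "H (f a *\<^sub>F s a + (\<lambda>q. \<Sum>i\<in>I. f i q *\<^sub>R s i q)) = f a *\<^sub>F H (s a) + H (\<lambda>q. \<Sum>i\<in>I. f i q *\<^sub>R s i q)"
      using assms(1) insert.prems sections_combination[of I f s]
      by (simp add: Cinf_linear_on_def sections_fmult)
    show ?case
      unfolding 1 2 using insert by (simp add: fmult_def plus_fun_def)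
  qed (use H0 in auto)
qed

text \<open>Near p write s as a sum of c_i X_i. Neither c_i nor X_i is global, so s is multiplied by
  \<eta> twice: one factor makes the coefficients global, the other the frame sections. Linearity
  then gives H s (p) as a sum of c_i(p) H(\<eta> X_i)(p), and all c_i(p) are 0.\<close>

lemma Cinf_linear_zero_at:
  assumes H: "Cinf_linear_on A (sections A E) H" and s: "s \<in> sections A E" "s p = 0"
  shows "H s p = 0"
proof -
  obtain U X where U: "(U, X) \<in> frames E" "p \<in> U" using frame_cover[of p] by auto
  have o: "open U" by (rule frame_open[OF U(1)])
  obtain \<eta> K W where \<eta>: "\<eta> \<in> Cinf A" "closed K" "K \<subseteq> U" "\<And>q. q \<notin> K \<Longrightarrow> \<eta> q = 0"
    "p \<in> W" "\<And>q. q \<in> W \<Longrightarrow> \<eta> q = 1"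
    by (rule bump_function[OF o U(2)]) blast
  let ?c = "\<lambda>i q. coframe (rank E) X i q (s q)"
  let ?f = "\<lambda>i q. if q \<in> U then \<eta> q * ?c i q else 0"
  let ?S = "\<lambda>i q. if q \<in> U then \<eta> q *\<^sub>R X i q else 0"
  have f: "?f i \<in> Cinf A" if "i < rank E" for i
    using smooth_fun_extend[OF o open_UNIV \<eta>(2,3,1,4), of "?c i"]
      section_on_coordinate[OF s(1)[unfolded sections_iff] open_UNIV U(1) that]
    by (simp add: Cinf_def)
  have S: "?S i \<in> sections A E" if "i < rank E" for i
    by (rule section_extend[OF o \<eta>(2,3,1,4) frame_section[OF U(1) that]])
  have "(\<eta> * \<eta>) *\<^sub>F s = (\<lambda>q. \<Sum>i<rank E. ?f i q *\<^sub>R ?S i q)"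
  proof
    fix q
    show "((\<eta> * \<eta>) *\<^sub>F s) q = (\<Sum>i<rank E. ?f i q *\<^sub>R ?S i q)"
    proof (cases "q \<in> U")
      case True
      have "(\<Sum>i<rank E. ?f i q *\<^sub>R ?S i q) = (\<eta> q * \<eta> q) *\<^sub>R (\<Sum>i<rank E. ?c i q *\<^sub>R X i q)"
        using True by (simp add: scaleR_sum_right mult_ac)
      also have "(\<Sum>i<rank E. ?c i q *\<^sub>R X i q) = s q"
        using coframe_expansion[of "fibre E q" "rank E" X q "s q"] frame_basis[OF U(1) True]
          sections_fibre[OF s(1)] by simp
      finally show ?thesis by (simp add: fmult_def times_fun_def)
    next
      case False
      then show ?thesis using \<eta>(3,4) by (auto simp: fmult_def times_fun_def)
    qed
  qed
  moreover have "H ((\<eta> * \<eta>) *\<^sub>F s) = (\<eta> * \<eta>) *\<^sub>F H s"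
    using H \<eta>(1) s(1) Cinf_mult by (auto simp: Cinf_linear_on_def)
  ultimately have "((\<eta> * \<eta>) *\<^sub>F H s) p = (\<Sum>i<rank E. ?f i p *\<^sub>R H (?S i) p)"
    using Cinf_linear_combination[OF H, of "{..<rank E}" ?f ?S] f S by simp
  also have "\<dots> = (\<Sum>i<rank E. 0)"
  proof (rule sum.cong)
    fix i assume "i \<in> {..<rank E}"
    then have "?c i p = 0"
      using coframe_sum[of "fibre E p" "rank E" X p i "\<lambda>i. 0"] frame_basis[OF U] s(2) by simp
    then show "?f i p *\<^sub>R H (?S i) p = 0" by simp
  qed simp
  finally show ?thesis
    using \<eta>(5,6) by (simp add: fmult_def times_fun_def)
qed

lemma Cinf_linear_pointwise:
  assumes H: "Cinf_linear_on A (sections A E) H"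
    and "s \<in> sections A E" "t \<in> sections A E" "s p = t p"
  shows "H s p = H t p"
proof -
  have d: "s - t \<in> sections A E" using assms(2,3) by (rule sections_diff)
  have "H (t + (s - t)) = H t + H (s - t)"
    using H d assms(3) unfolding Cinf_linear_on_def by blast
  then show ?thesis
    using Cinf_linear_zero_at[OF H d, of p] assms(4) by simp
qed

end


lemma sum_fun_apply:
  fixes f :: "'i \<Rightarrow> 'x \<Rightarrow> 'y::comm_monoid_add"
  shows "(\<Sum>i\<in>I. f i) x = (\<Sum>i\<in>I. f i x)"
  by (induction I rule: infinite_finite_induct) auto


section \<open>The dual bundle and local frames\<close>

context smooth_bundle
begin

text \<open>The equality is between functions on all of \<open>'f\<close>: inside the fibre it is
  linearity applied to the coframe expansion, outside both sides are 0 by normalisation.\<close>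

lemma dual_expansion:
  assumes b: "is_basis (fibre E p) (rank E) (\<lambda>i. X i p)" and \<alpha>: "\<alpha> \<in> fibre (dual_bundle E) p"
  shows "\<alpha> = (\<Sum>j<rank E. \<alpha> (X j p) *\<^sub>R coframe (rank E) X j p)"
proof
  fix v
  have *: "(\<Sum>j<rank E. \<alpha> (X j p) *\<^sub>R coframe (rank E) X j p) v =
      (\<Sum>j<rank E. \<alpha> (X j p) * coframe (rank E) X j p v)"
    by (simp add: sum_fun_apply scaleR_fun_def)
  show "\<alpha> v = (\<Sum>j<rank E. \<alpha> (X j p) *\<^sub>R coframe (rank E) X j p) v"
  proof (cases "v \<in> fibre E p")
    case True
    have lin: "linear_on_set (fibre E p) \<alpha>"
      using \<alpha> by (simp add: dual_bundle_def)
    have "\<alpha> v = \<alpha> (\<Sum>j<rank E. coframe (rank E) X j p v *\<^sub>R X j p)"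
      using coframe_expansion[of "fibre E p" "rank E" X p v] b True by simp
    also have "\<dots> = (\<Sum>j<rank E. coframe (rank E) X j p v *\<^sub>R \<alpha> (X j p))"
      by (rule linear_on_set_sum[OF lin fibre_subspace]) (use is_basis_mem[OF b] in auto)
    finally show ?thesis
      by (simp add: * mult_ac)
  next
    case False
    then have "coframe (rank E) X j p v = 0" for j
      using coframe_outside[of "fibre E p" "rank E" X p v] b by simp
    moreover have "\<alpha> v = 0" using \<alpha> False by (simp add: dual_bundle_def)
    ultimately show ?thesis by (simp add: *)
  qed
qed

lemma coframe_mem_dual:
  assumes "is_basis (fibre E p) (rank E) (\<lambda>i. X i p)" "i < rank E"
  shows "coframe (rank E) X i p \<in> fibre (dual_bundle E) p"
  using coframe_linear[of "fibre E p" "rank E" X p i] coframe_outside[of "fibre E p" "rank E" X p] assms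
  by (simp add: dual_bundle_def)

lemma dual_fibre_subspace: "subspace (fibre (dual_bundle E) p)"
  by (rule subspaceI)
    (auto simp: dual_bundle_def linear_on_set_def scaleR_fun_def algebra_simps)

lemma dual_basis:
  assumes b: "is_basis (fibre E p) (rank E) (\<lambda>i. X i p)"
  shows "is_basis (fibre (dual_bundle E) p) (rank E) (\<lambda>i. coframe (rank E) X i p)"
proof (rule is_basisI[OF dual_fibre_subspace])
  show "coframe (rank E) X i p \<in> fibre (dual_bundle E) p" if "i < rank E" for i
    using coframe_mem_dual[of p X i] b that by simp
  show "\<exists>c. \<alpha> = (\<Sum>i<rank E. c i *\<^sub>R coframe (rank E) X i p)" if "\<alpha> \<in> fibre (dual_bundle E) p" for \<alpha>
    using dual_expansion[of p X \<alpha>] b that by (intro exI[of _ "\<lambda>j. \<alpha> (X j p)"])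
  fix c i assume c: "(\<Sum>j<rank E. c j *\<^sub>R coframe (rank E) X j p) = 0" and i: "i < rank E"
  have "0 = (\<Sum>j<rank E. c j *\<^sub>R coframe (rank E) X j p) (X i p)"
    using c by simp
  also have "\<dots> = (\<Sum>j<rank E. c j * coframe (rank E) X j p (X i p))"
    by (simp add: sum_fun_apply scaleR_fun_def)
  also have "\<dots> = (\<Sum>j<rank E. if j = i then c j else 0)"
    using coframe_delta[of "fibre E p" "rank E" X p] b i by (intro sum.cong) auto
  finally show "c i = 0" using i by simp
qed

text \<open>The transition coefficients between two coframes are the numbers e^i(Y_j), that is,
  coordinates of the frame sections Y_j of \<open>E\<close>, which are already smooth. As a result,
  pointwise dependence applies also to the covector slot of \<open>L\<close>.\<close>

lemma dual_smooth_bundle: "smooth_bundle A (dual_bundle E)"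
proof
  have fr: "frames (dual_bundle E) = {(U, coframe (rank E) X) |U X. (U, X) \<in> frames E}"
    and rk: "rank (dual_bundle E) = rank E"
    by (simp_all add: dual_bundle_def)
  have "smooth_section_on A (dual_bundle E) U (coframe (rank E) X i)"
    if U: "(U, X) \<in> frames E" and i: "i < rank E" for U X i
  proof (rule smooth_section_onI)
    show "coframe (rank E) X i p \<in> fibre (dual_bundle E) p" if "p \<in> U" for p
      using coframe_mem_dual[of p X i] frame_basis[OF U that] i by simp
    fix V Y' assume "(V, Y') \<in> frames (dual_bundle E)"
    then obtain Y where V: "(V, Y) \<in> frames E" and Y': "Y' = coframe (rank E) Y"
      by (auto simp: fr)
    have "smooth_fun A (V \<inter> U) (\<lambda>p. coframe (rank E) X i p (Y j p))" if "j < rank E" for j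
      using section_on_coordinate[OF frame_section[OF V that] frame_open[OF V] U i]
      by (simp add: Int_commute)
    moreover have "coframe (rank E) X i p =
        (\<Sum>j<rank E. coframe (rank E) X i p (Y j p) *\<^sub>R coframe (rank E) Y j p)" if "p \<in> V \<inter> U" for p
      using dual_expansion[of p Y "coframe (rank E) X i p"] coframe_mem_dual[of p X i] that i
        frame_basis[OF U, of p] frame_basis[OF V, of p] by simp
    ultimately show "\<exists>c. (\<forall>j<rank (dual_bundle E). smooth_fun A (V \<inter> U) (c j)) \<and>
        (\<forall>p\<in>V \<inter> U. coframe (rank E) X i p = (\<Sum>j<rank (dual_bundle E). c j p *\<^sub>R Y' j p))"
      unfolding rk Y' by (intro exI[of _ "\<lambda>j p. coframe (rank E) X i p (Y j p)"]) auto
  qed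
  moreover have "(\<Union>(U, X)\<in>frames (dual_bundle E). U) = (\<Union>(U, X)\<in>frames E. U)"
    unfolding fr by auto
  moreover have "(\<Union>(U, X)\<in>frames E. U) = UNIV"
    using vb by (simp add: vector_bundle_def)
  ultimately show "vector_bundle A (dual_bundle E)"
    unfolding vector_bundle_def rk
    using dual_fibre_subspace dual_basis frame_open frame_basis by (auto simp: fr)
qed

text \<open>Frame and coframe are multiplied by the same bump function. Where it equals 1 they are
  the original ones, so duality holds there; elsewhere duality is not demanded. Thus the choice
  inside \<open>loc_term\<close> always has a witness.\<close>

lemma local_frame_exists: "\<exists>X e. local_frame_near A E p X e"
proof -
  obtain U Y where U: "(U, Y) \<in> frames E" "p \<in> U" using frame_cover[of p] by auto
  have o: "open U" by (rule frame_open[OF U(1)])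
  obtain \<eta> K W where \<eta>: "\<eta> \<in> Cinf A" "closed K" "K \<subseteq> U" "\<And>q. q \<notin> K \<Longrightarrow> \<eta> q = 0"
    and W: "open W" "p \<in> W" "W \<subseteq> U" "\<And>q. q \<in> W \<Longrightarrow> \<eta> q = 1"
    by (rule bump_function[OF o U(2)]) blast
  define X where "X a q = (if q \<in> U then \<eta> q *\<^sub>R Y a q else 0)" for a q
  define e where "e a q = (if q \<in> U then \<eta> q *\<^sub>R coframe (rank E) Y a q else 0)" for a q
  have "X a \<in> sections A E" if "a < rank E" for a
    unfolding X_def[abs_def]
    by (rule section_extend[OF o \<eta>(2,3,1,4) frame_section[OF U(1) that]])
  moreover have "e a \<in> sections A (dual_bundle E)" if "a < rank E" for a
  proof -
    have "(U, coframe (rank E) Y) \<in> frames (dual_bundle E)" "a < rank (dual_bundle E)"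
      using U that by (auto simp: dual_bundle_def)
    then show ?thesis
      unfolding e_def[abs_def]
      by (intro smooth_bundle.section_extend[OF dual_smooth_bundle o \<eta>(2,3,1,4)]
          smooth_bundle.frame_section[OF dual_smooth_bundle])
  qed
  moreover have "is_basis (fibre E q) (rank E) (\<lambda>a. X a q) \<and>
      (\<forall>a<rank E. e a q = coframe (rank E) X a q)" if "q \<in> W" for q
  proof -
    have "q \<in> U" "\<eta> q = 1" using that W by auto
    then have "X a q = Y a q" "e a q = coframe (rank E) Y a q" for a
      by (auto simp: X_def e_def)
    then show ?thesis
      using frame_basis[OF U(1) \<open>q \<in> U\<close>] by (simp add: coframe_def)
  qed
  ultimately have "local_frame_near A E p X e"
    unfolding local_frame_near_def using W by auto
  then show ?thesis by auto
qed

lemma local_frame_nearD: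
  assumes "local_frame_near A E p X e"
  shows "\<And>a. a < rank E \<Longrightarrow> X a \<in> sections A E"
    and "\<And>a. a < rank E \<Longrightarrow> e a \<in> sections A (dual_bundle E)"
    and "is_basis (fibre E p) (rank E) (\<lambda>a. X a p)"
    and "\<And>a. a < rank E \<Longrightarrow> e a p = coframe (rank E) X a p"
  using assms unfolding local_frame_near_def by auto

text \<open>The neighbourhood that witnesses the property at p also witnesses it at each of its
  points. A single frame can therefore be used on a whole open set, which smoothness arguments
  require.\<close>

lemma local_frame_near_open:
  assumes "local_frame_near A E p X e"
  obtains W where "open W" "p \<in> W" "\<And>q. q \<in> W \<Longrightarrow> local_frame_near A E q X e"
proof -
  obtain W where W: "open W" "p \<in> W" "\<forall>q\<in>W. is_basis (fibre E q) (rank E) (\<lambda>a. X a q) \<and>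
        (\<forall>a<rank E. e a q = coframe (rank E) X a q)"
    using assms unfolding local_frame_near_def by auto
  moreover have "local_frame_near A E q X e" if "q \<in> W" for q
    using assms W that unfolding local_frame_near_def by auto
  ultimately show ?thesis using that by auto
qed

text \<open>The transition matrix at \<open>p\<close> acts on the frame and on the coframe, and cancels in the pairing.\<close>

lemma contraction_frame_independent:
  assumes B1: "\<And>x. x \<in> sections A E \<Longrightarrow> Cinf_linear_on A (sections A (dual_bundle E)) (\<lambda>\<alpha>. B \<alpha> x)"
    and B2: "\<And>\<alpha>. \<alpha> \<in> sections A (dual_bundle E) \<Longrightarrow> Cinf_linear_on A (sections A E) (B \<alpha>)"
    and F: "local_frame_near A E p X e" and F': "local_frame_near A E p X' e'"
  shows "(\<Sum>a<rank E. B (e a) (X a) p) = (\<Sum>a<rank E. B (e' a) (X' a) p)"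
proof -
  interpret dual: smooth_bundle A "dual_bundle E" by (rule dual_smooth_bundle)
  note f = local_frame_nearD[OF F] and f' = local_frame_nearD[OF F']
  \<comment> \<open>These are constants taken at p. The combinations formed with them agree with
    e'^a and X_b only at p, which suffices because \<open>B\<close> depends pointwise on both
    arguments.\<close>
  let ?m = "\<lambda>a b. e' a p (X b p)"
  have 1: "B (e' a) (X' a) p = (\<Sum>b<rank E. ?m a b *\<^sub>R B (e b) (X' a) p)" if a: "a < rank E" for a
  proof -
    have "e' a p = (\<Sum>b<rank E. ?m a b *\<^sub>R coframe (rank E) X b p)"
      using dual_expansion[of p X "e' a p"] f(3) sections_fibre[OF f'(2)[OF a]] by simp
    then have "e' a p = (\<lambda>q. \<Sum>b<rank E. ?m a b *\<^sub>R e b q) p"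
      using f(4) by simp
    then have "B (e' a) (X' a) p = B (\<lambda>q. \<Sum>b<rank E. ?m a b *\<^sub>R e b q) (X' a) p"
      by (intro dual.Cinf_linear_pointwise[OF B1[OF f'(1)[OF a]] f'(2)[OF a]]
          dual.sections_combination[where f = "\<lambda>b q. ?m a b"])
        (use f(2) Cinf_const in auto)
    also have "\<dots> = (\<Sum>b<rank E. ?m a b *\<^sub>R B (e b) (X' a) p)"
      by (subst dual.Cinf_linear_combination[OF B1[OF f'(1)[OF a]], where f = "\<lambda>b q. ?m a b"])
        (use f(2) Cinf_const in auto)
    finally show ?thesis .
  qed
  have 2: "B (e b) (X b) p = (\<Sum>a<rank E. ?m a b *\<^sub>R B (e b) (X' a) p)" if b: "b < rank E" for b
  proof -
    have "X b p = (\<lambda>q. \<Sum>a<rank E. ?m a b *\<^sub>R X' a q) p"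
      using coframe_expansion[of "fibre E p" "rank E" X' p "X b p"] f'(3,4) sections_fibre[OF f(1)[OF b]]
      by simp
    then have "B (e b) (X b) p = B (e b) (\<lambda>q. \<Sum>a<rank E. ?m a b *\<^sub>R X' a q) p"
      by (intro Cinf_linear_pointwise[OF B2[OF f(2)[OF b]] f(1)[OF b]]
          sections_combination[where f = "\<lambda>a q. ?m a b"])
        (use f'(1) Cinf_const in auto)
    also have "\<dots> = (\<Sum>a<rank E. ?m a b *\<^sub>R B (e b) (X' a) p)"
      by (subst Cinf_linear_combination[OF B2[OF f(2)[OF b]], where f = "\<lambda>a q. ?m a b"])
        (use f'(1) Cinf_const in auto)
    finally show ?thesis .
  qed
  have "(\<Sum>a<rank E. B (e' a) (X' a) p) = (\<Sum>a<rank E. \<Sum>b<rank E. ?m a b *\<^sub>R B (e b) (X' a) p)"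
    using 1 by (intro sum.cong) auto
  also have "\<dots> = (\<Sum>b<rank E. \<Sum>a<rank E. ?m a b *\<^sub>R B (e b) (X' a) p)"
    by (rule sum.swap)
  also have "\<dots> = (\<Sum>b<rank E. B (e b) (X b) p)"
    using 2 by (intro sum.cong) auto
  finally show ?thesis by simp
qed

end


section \<open>Linear systems with smooth coefficients\<close>

lemma det_nonzero_if_injective:
  fixes M :: "nat \<Rightarrow> nat \<Rightarrow> real"
  assumes "\<And>c a. (\<And>b. b < n \<Longrightarrow> (\<Sum>a<n. M b a * c a) = 0) \<Longrightarrow> a < n \<Longrightarrow> c a = 0"
  shows "det (mat n n (\<lambda>(b, a). M b a)) \<noteq> 0"
proof
  let ?A = "mat n n (\<lambda>(b, a). M b a)"
  assume "det ?A = 0"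
  then obtain v where v: "v \<in> carrier_vec n" "v \<noteq> 0\<^sub>v n" "?A *\<^sub>v v = 0\<^sub>v n"
    using det_0_iff_vec_prod_zero[of ?A n] by auto
  have "(\<Sum>a<n. M b a * vec_index v a) = 0" if "b < n" for b
  proof -
    have "vec_index (?A *\<^sub>v v) b = (\<Sum>a<n. M b a * vec_index v a)"
      using that v(1) by (auto simp: scalar_prod_def atLeast0LessThan intro!: sum.cong)
    then show ?thesis using v(3) that by simp
  qed
  then have "vec_index v a = 0" if "a < n" for a
    using assms[of "\<lambda>a. vec_index v a" a] that by simp
  then have "v = 0\<^sub>v n" using v(1) by (intro eq_vecI) auto
  then show False using v(2) by simp
qed

text \<open>Cramer's rule, from R adj(R) = det(R) I. Entry (a, d) of the adjugate is the cofactor at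
  (d, a), whence the exchanged indices. The explicit formula lets smooth dependence on parameters be
  read off.\<close>

lemma adj_mat_solves:
  fixes M :: "nat \<Rightarrow> nat \<Rightarrow> real" and n :: nat
  defines "R \<equiv> mat n n (\<lambda>(b, a). M b a)"
  assumes "det R \<noteq> 0" "b < n"
  shows "(\<Sum>a<n. M b a * ((\<Sum>d<n. cofactor R d a * h d) * inverse (det R))) = h b"
proof -
  have R: "R \<in> carrier_mat n n" by (simp add: R_def)
  have *: "(\<Sum>a<n. M b a * cofactor R d a) = (if b = d then det R else 0)" if "d < n" for d
  proof -
    have "(R * adj_mat R) $$ (b, d) = (\<Sum>a<n. M b a * cofactor R d a)"
      using assms(3) that
      by (auto simp: R_def adj_mat_def scalar_prod_def atLeast0LessThan intro!: sum.cong)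
    moreover have "(R * adj_mat R) $$ (b, d) = (det R \<cdot>\<^sub>m 1\<^sub>m n) $$ (b, d)"
      using adj_mat(2)[OF R] by simp
    moreover have "(det R \<cdot>\<^sub>m 1\<^sub>m n) $$ (b, d) = (if b = d then det R else 0)"
      using assms(3) that by simp
    ultimately show ?thesis by (simp only:)
  qed
  have "(\<Sum>a<n. M b a * ((\<Sum>d<n. cofactor R d a * h d) * inverse (det R))) =
      (\<Sum>a<n. \<Sum>d<n. M b a * cofactor R d a * (h d * inverse (det R)))"
    by (simp add: sum_distrib_left sum_distrib_right mult_ac)
  also have "\<dots> = (\<Sum>d<n. \<Sum>a<n. M b a * cofactor R d a * (h d * inverse (det R)))"
    by (rule sum.swap)
  also have "\<dots> = (\<Sum>d<n. (if b = d then det R else 0) * (h d * inverse (det R)))"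
    by (intro sum.cong) (auto simp: * simp flip: sum_distrib_right)
  also have "\<dots> = (\<Sum>d<n. if d = b then h b else 0)"
    using assms(2) by (intro sum.cong) auto
  finally show ?thesis using assms(3) by simp
qed

context smooth_manifold
begin

text \<open>By the Leibniz expansion the determinant is a polynomial in the entries.\<close>

lemma smooth_fun_det:
  assumes "open W" "\<And>i j. i < n \<Longrightarrow> j < n \<Longrightarrow> smooth_fun A W (\<lambda>p. M p i j)"
  shows "smooth_fun A W (\<lambda>p. det (mat n n (\<lambda>(i, j). M p i j)))"
proof -
  have "det (mat n n (\<lambda>(i, j). M p i j)) =
      (\<Sum>\<pi>\<in>{\<pi>. \<pi> permutes {0..<n}}. signof \<pi> * (\<Prod>i=0..<n. M p i (\<pi> i)))" for p
    by (auto simp: det_def permutes_in_image intro!: sum.cong prod.cong)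
  moreover have "smooth_fun A W (\<lambda>p. \<Sum>\<pi>\<in>{\<pi>. \<pi> permutes {0..<n}}. signof \<pi> * (\<Prod>i=0..<n. M p i (\<pi> i)))"
  proof (rule smooth_fun_sum[OF assms(1)])
    fix \<pi> assume \<pi>: "\<pi> \<in> {\<pi>. \<pi> permutes {0..<n}}"
    have "smooth_fun A W (\<lambda>p. M p i (\<pi> i))" if "i \<in> {0..<n}" for i
      using assms(2)[of i "\<pi> i"] \<pi> that permutes_in_image[of \<pi> "{0..<n}" i] by auto
    then show "smooth_fun A W (\<lambda>p. signof \<pi> * (\<Prod>i=0..<n. M p i (\<pi> i)))"
      using smooth_fun_mult[OF assms(1) smooth_fun_const[OF assms(1)] smooth_fun_prod[OF assms(1)],
          of "{0..<n}" "\<lambda>i p. M p i (\<pi> i)"] by auto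
  qed
  ultimately show ?thesis by simp
qed

lemma smooth_fun_cofactor:
  assumes "open W" "\<And>i j. i < n \<Longrightarrow> j < n \<Longrightarrow> smooth_fun A W (\<lambda>p. M p i j)" "i < n" "j < n"
  shows "smooth_fun A W (\<lambda>p. cofactor (mat n n (\<lambda>(i, j). M p i j)) i j)"
proof -
  \<comment> \<open>The map \<open>?s i\<close> enumerates the indices other than \<open>i\<close>,
    so a cofactor is up to sign a determinant of entries of the same matrix.\<close>
  let ?s = "\<lambda>i a. if a < i then a else Suc a"
  have "cofactor (mat n n (\<lambda>(i, j). M p i j)) i j =
      (- 1) ^ (i + j) * det (mat (n - 1) (n - 1) (\<lambda>(a, b). M p (?s i a) (?s j b)))" for p
    unfolding cofactor_def mat_delete_def using assms(3,4)
    by (auto intro!: arg_cong[of _ _ det] eq_matI)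
  moreover have "smooth_fun A W (\<lambda>p. det (mat (n - 1) (n - 1) (\<lambda>(a, b). M p (?s i a) (?s j b))))"
    using assms(3,4)
    by (intro smooth_fun_det[OF assms(1), where M = "\<lambda>p a b. M p (?s i a) (?s j b)"] assms(2)) auto
  then have "smooth_fun A W (\<lambda>p. (- 1) ^ (i + j) * det (mat (n - 1) (n - 1) (\<lambda>(a, b). M p (?s i a) (?s j b))))"
    by (rule smooth_fun_mult[OF assms(1) smooth_fun_const[OF assms(1)]])
  ultimately show ?thesis by simp
qed

end


section \<open>The anchor as a derivation\<close>

context smooth_manifold
begin

text \<open>The coordinate frames of the tangent bundle are indexed by bases of \<open>'n\<close>;
  this supplies one such frame over every chart.\<close>

lemma model_basis: "\<exists>b. is_basis (UNIV :: 'n set) (dim (UNIV :: 'n set)) b"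
proof -
  obtain S :: "'n set" where S: "finite S" "span S = UNIV"
    using atlas[unfolded smooth_atlas_def, THEN conjunct1] by auto
  obtain B :: "'n set" where B: "independent B" "UNIV \<subseteq> span B" "card B = dim (UNIV :: 'n set)"
    by (rule basis_exists[of "UNIV :: 'n set"]) auto
  have "finite B"
    using independent_span_bound[OF S(1) B(1)] S(2) by simp
  then obtain h where h: "bij_betw h {0..<card B} B"
    using ex_bij_betw_nat_finite[of B] by auto
  then have "h ` {..<dim (UNIV :: 'n set)} = B" "inj_on h {..<dim (UNIV :: 'n set)}"
    using B(3) by (auto simp: bij_betw_def atLeast0LessThan)
  then have "is_basis (UNIV :: 'n set) (dim (UNIV :: 'n set)) h"
    using B by (auto simp: is_basis_def)
  then show ?thesis by auto
qed

text \<open>In each chart the coordinate frame of that same chart is used, so that no chain rule is needed.\<close>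

lemma tangent_section_apply_smooth:
  assumes t: "smooth_section_on A (tangent_bundle A) W t" and "open W" and f: "f \<in> Cinf A"
  shows "smooth_fun A W (\<lambda>p. t p f)"
proof (rule smooth_funI)
  fix V \<phi> assume V: "(V, \<phi>) \<in> A"
  let ?d = "dim (UNIV :: 'n set)" and ?S = "\<phi> ` (V \<inter> W)"
  obtain b :: "nat \<Rightarrow> 'n" where b: "is_basis UNIV ?d b" using model_basis by auto
  have fr: "(V, \<lambda>i. coordinate_vector A (V, \<phi>) (b i)) \<in> frames (tangent_bundle A)"
    using V b by (auto simp: tangent_bundle_def)
  obtain c where c: "\<forall>i<rank (tangent_bundle A). smooth_fun A (V \<inter> W) (c i)"
    "\<forall>p\<in>V \<inter> W. t p = (\<Sum>i<rank (tangent_bundle A). c i p *\<^sub>R coordinate_vector A (V, \<phi>) (b i) p)"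
    by (rule smooth_section_on_coefficients[OF t fr])
  have rk: "rank (tangent_bundle A) = ?d" by (simp add: tangent_bundle_def)
  have o: "open ?S" by (rule chart_image_Int_open[OF V \<open>open W\<close>])
  let ?F = "\<lambda>x. \<Sum>i<?d. c i (inv_into V \<phi> x) * frechet_derivative (f \<circ> inv_into V \<phi>) (at x) (b i)"
  have sm: "smooth_on ?S (\<lambda>x. c i (inv_into V \<phi> x) * frechet_derivative (f \<circ> inv_into V \<phi>) (at x) (b i))"
    if "i < ?d" for i
  proof (rule smooth_on_mult[OF o])
    have "smooth_fun A (V \<inter> W) (c i)" using c(1) that rk by simp
    then show "smooth_on ?S (\<lambda>x. c i (inv_into V \<phi> x))"
      using smooth_funD[OF _ V, of "V \<inter> W" "c i"] by simp
    have "smooth_on (\<phi> ` V) (f \<circ> inv_into V \<phi>)"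
      using f V unfolding Cinf_def smooth_fun_def by (auto dest!: bspec)
    then show "smooth_on ?S (\<lambda>x. frechet_derivative (f \<circ> inv_into V \<phi>) (at x) (b i))"
      by (intro smooth_on_directional, elim smooth_on_subset) auto
  qed
  have "smooth_on ?S ?F"
    by (rule smooth_on_sum[OF o]) (use sm in auto)
  moreover have "?F x = t (inv_into V \<phi> x) f" if "x \<in> ?S" for x
  proof -
    obtain p where p: "p \<in> V" "p \<in> W" "x = \<phi> p" using \<open>x \<in> ?S\<close> by blast
    then have "t p f = (\<Sum>i<?d. c i p *\<^sub>R coordinate_vector A (V, \<phi>) (b i) p) f"
      using c(2) rk by simp
    then show ?thesis
      using chart_inv[OF V p(1)] f p(3)
      by (simp add: sum_fun_apply scaleR_fun_def coordinate_vector_def)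
  qed
  ultimately show "smooth_on ?S (\<lambda>x. t (inv_into V \<phi> x) f)"
    using smooth_on_cong[OF o, of ?F "\<lambda>x. t (inv_into V \<phi> x) f"] by simp
qed

end

locale anchored_bundle = smooth_bundle A E
  for A :: "('m::{t2_space,second_countable_topology}, 'n::real_inner) chart set"
    and E :: "('m, 'f::real_vector) vbundle" +
  fixes \<rho> :: "('m, 'f) anchor"
  assumes anchor: "vb_morphism A E (tangent_bundle A) \<rho>"
begin

lemma anchor_linear: "linear_on_set (fibre E p) (\<rho> p)"
  and anchor_frame: "(U, X) \<in> frames E \<Longrightarrow> i < rank E \<Longrightarrow>
    smooth_section_on A (tangent_bundle A) U (\<lambda>p. \<rho> p (X i p))"
  using anchor unfolding vb_morphism_def by (auto dest!: bspec)

lemma anchor_tangent: "v \<in> fibre E p \<Longrightarrow> \<rho> p v \<in> tangent_space A p"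
  using anchor unfolding vb_morphism_def by (auto simp: tangent_bundle_def Pi_iff)

lemma anchor_app_Cinf:
  assumes u: "u \<in> sections A E" and f: "f \<in> Cinf A"
  shows "anchor_app \<rho> u f \<in> Cinf A"
proof -
  have "smooth_fun A UNIV (anchor_app \<rho> u f)"
  proof (rule smooth_fun_local)
    fix p :: 'm
    obtain U X where U: "(U, X) \<in> frames E" "p \<in> U" using frame_cover[of p] by auto
    have o: "open U" by (rule frame_open[OF U(1)])
    obtain c where c: "\<forall>i<rank E. smooth_fun A (U \<inter> UNIV) (c i)"
      "\<forall>p\<in>U \<inter> UNIV. u p = (\<Sum>i<rank E. c i p *\<^sub>R X i p)"
      by (rule smooth_section_on_coefficients[OF u[unfolded sections_iff] U(1)])
    have "smooth_fun A U (\<lambda>q. \<Sum>i<rank E. c i q * \<rho> q (X i q) f)"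
      using c(1) by (intro smooth_fun_sum[OF o] smooth_fun_mult[OF o]
          tangent_section_apply_smooth[OF anchor_frame[OF U(1)] o f]) auto
    moreover have "(\<Sum>i<rank E. c i q * \<rho> q (X i q) f) = anchor_app \<rho> u f q" if q: "q \<in> U" for q
    proof -
      have "u q = (\<Sum>i<rank E. c i q *\<^sub>R X i q)" using c(2) q by simp
      then have "\<rho> q (u q) = (\<Sum>i<rank E. c i q *\<^sub>R \<rho> q (X i q))"
        using linear_on_set_sum[OF anchor_linear fibre_subspace, of "{..<rank E}" "\<lambda>i. X i q" q "\<lambda>i. c i q"]
          is_basis_mem[OF frame_basis[OF U(1) q]] by simp
      then show ?thesis by (simp add: anchor_app_def sum_fun_apply scaleR_fun_def)
    qed
    ultimately have "smooth_fun A U (anchor_app \<rho> u f)"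
      by (rule smooth_fun_cong[OF o, rotated])
    then show "\<exists>V. open V \<and> p \<in> V \<and> smooth_fun A (UNIV \<inter> V) (anchor_app \<rho> u f)"
      using o U(2) by auto
  qed simp
  then show ?thesis by (simp add: Cinf_def)
qed

lemma anchor_app_add_left:
  "u \<in> sections A E \<Longrightarrow> v \<in> sections A E \<Longrightarrow> anchor_app \<rho> (u + v) f = anchor_app \<rho> u f + anchor_app \<rho> v f"
  using anchor_linear by (auto simp: anchor_app_def linear_on_set_def sections_fibre)

lemma anchor_app_fmult_left:
  "u \<in> sections A E \<Longrightarrow> anchor_app \<rho> (h *\<^sub>F u) f = h * anchor_app \<rho> u f"
  using anchor_linear
  by (auto simp: anchor_app_def linear_on_set_def sections_fibre fmult_def scaleR_fun_def times_fun_def)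

lemma anchor_app_add:
  assumes "u \<in> sections A E" "f \<in> Cinf A" "h \<in> Cinf A"
  shows "anchor_app \<rho> u (f + h) = anchor_app \<rho> u f + anchor_app \<rho> u h"
proof
  show "anchor_app \<rho> u (f + h) p = (anchor_app \<rho> u f + anchor_app \<rho> u h) p" for p
    using anchor_tangent[OF sections_fibre[OF assms(1)], of p] assms(2,3)
    unfolding anchor_app_def tangent_space_def linear_on_set_def by auto
qed

lemma anchor_app_mult:
  assumes "u \<in> sections A E" "f \<in> Cinf A" "h \<in> Cinf A"
  shows "anchor_app \<rho> u (f * h) = anchor_app \<rho> u f * h + f * anchor_app \<rho> u h"
proof
  fix p
  show "anchor_app \<rho> u (f * h) p = (anchor_app \<rho> u f * h + f * anchor_app \<rho> u h) p"
    using anchor_tangent[OF sections_fibre[OF assms(1)], of p] assms(2,3)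
    unfolding anchor_app_def tangent_space_def by (auto simp: times_fun_def)
qed

end


section \<open>Metrics and raising an index\<close>

locale metric_bundle = smooth_bundle A E
  for A :: "('m::{t2_space,second_countable_topology}, 'n::real_inner) chart set"
    and E :: "('m, 'f::real_vector) vbundle" +
  fixes g :: "'m \<Rightarrow> 'f \<Rightarrow> 'f \<Rightarrow> real"
  assumes metric: "E_metric A E g"
begin

lemma metric_linear: "v \<in> fibre E p \<Longrightarrow> linear_on_set (fibre E p) (g p v)"
  and metric_sym: "v \<in> fibre E p \<Longrightarrow> w \<in> fibre E p \<Longrightarrow> g p v w = g p w v"
  using metric unfolding E_metric_def by auto

lemma metric_nondegenerate:
  "v \<in> fibre E p \<Longrightarrow> (\<And>w. w \<in> fibre E p \<Longrightarrow> g p v w = 0) \<Longrightarrow> v = 0"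
  using metric unfolding E_metric_def by blast

lemma metric_frame:
  "(U, X) \<in> frames E \<Longrightarrow> i < rank E \<Longrightarrow> j < rank E \<Longrightarrow> smooth_fun A U (\<lambda>p. g p (X i p) (X j p))"
  using metric unfolding E_metric_def by (auto dest!: bspec)

lemma metric_linear_left:
  "v \<in> fibre E p \<Longrightarrow> linear_on_set (fibre E p) (\<lambda>w. g p w v)"
  using metric_linear[of v p] metric_sym[of v p] subspace_add[OF fibre_subspace] subspace_scale[OF fibre_subspace]
  unfolding linear_on_set_def by simp

lemma metric_app_Cinf:
  assumes u: "u \<in> sections A E" and v: "v \<in> sections A E"
  shows "metric_app g u v \<in> Cinf A"
proof -
  have "smooth_fun A UNIV (metric_app g u v)"
  proof (rule smooth_fun_local)
    fix p :: 'm
    obtain U X where U: "(U, X) \<in> frames E" "p \<in> U" using frame_cover[of p] by auto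
    have o: "open U" by (rule frame_open[OF U(1)])
    obtain c where c: "\<forall>i<rank E. smooth_fun A (U \<inter> UNIV) (c i)"
      "\<forall>p\<in>U \<inter> UNIV. u p = (\<Sum>i<rank E. c i p *\<^sub>R X i p)"
      by (rule smooth_section_on_coefficients[OF u[unfolded sections_iff] U(1)])
    obtain d where d: "\<forall>i<rank E. smooth_fun A (U \<inter> UNIV) (d i)"
      "\<forall>p\<in>U \<inter> UNIV. v p = (\<Sum>i<rank E. d i p *\<^sub>R X i p)"
      by (rule smooth_section_on_coefficients[OF v[unfolded sections_iff] U(1)])
    have "smooth_fun A U (\<lambda>q. \<Sum>i<rank E. c i q * (\<Sum>j<rank E. d j q * g q (X i q) (X j q)))"
      using c(1) d(1)
      by (intro smooth_fun_sum[OF o] smooth_fun_mult[OF o] metric_frame[OF U(1)]) auto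
    moreover have "(\<Sum>i<rank E. c i q * (\<Sum>j<rank E. d j q * g q (X i q) (X j q))) = metric_app g u v q"
      if q: "q \<in> U" for q
    proof -
      note X = is_basis_mem[OF frame_basis[OF U(1) q]]
      have uq: "u q = (\<Sum>i<rank E. c i q *\<^sub>R X i q)" and vq: "v q = (\<Sum>i<rank E. d i q *\<^sub>R X i q)"
        using c(2) d(2) q by simp_all
      have "metric_app g u v q = (\<Sum>i<rank E. c i q *\<^sub>R g q (X i q) (v q))"
        unfolding metric_app_def uq
        by (rule linear_on_set_sum[OF metric_linear_left[OF sections_fibre[OF v]] fibre_subspace])
          (use X in auto)
      also have "\<dots> = (\<Sum>i<rank E. c i q *\<^sub>R (\<Sum>j<rank E. d j q *\<^sub>R g q (X i q) (X j q)))"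
      proof (rule sum.cong)
        fix i assume "i \<in> {..<rank E}"
        then have "g q (X i q) (v q) = (\<Sum>j<rank E. d j q *\<^sub>R g q (X i q) (X j q))"
          unfolding vq using X by (intro linear_on_set_sum[OF metric_linear fibre_subspace]) auto
        then show "c i q *\<^sub>R g q (X i q) (v q) = c i q *\<^sub>R (\<Sum>j<rank E. d j q *\<^sub>R g q (X i q) (X j q))"
          by simp
      qed simp
      finally show ?thesis by simp
    qed
    ultimately have "smooth_fun A U (metric_app g u v)"
      by (rule smooth_fun_cong[OF o, rotated])
    then show "\<exists>V. open V \<and> p \<in> V \<and> smooth_fun A (UNIV \<inter> V) (metric_app g u v)"
      using o U(2) by auto
  qed simp
  then show ?thesis by (simp add: Cinf_def)
qed

lemma metric_app_sym:
  "u \<in> sections A E \<Longrightarrow> v \<in> sections A E \<Longrightarrow> metric_app g u v = metric_app g v u"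
  by (auto simp: metric_app_def metric_sym sections_fibre)

lemma metric_app_add_left:
  assumes "u \<in> sections A E" "u' \<in> sections A E" "v \<in> sections A E"
  shows "metric_app g (u + u') v = metric_app g u v + metric_app g u' v"
proof
  show "metric_app g (u + u') v p = (metric_app g u v + metric_app g u' v) p" for p
    using metric_linear_left[OF sections_fibre[OF assms(3)], of p] assms(1,2)[THEN sections_fibre]
    unfolding metric_app_def linear_on_set_def by auto
qed

lemma metric_app_fmult_left:
  assumes "u \<in> sections A E" "v \<in> sections A E"
  shows "metric_app g (f *\<^sub>F u) v = f * metric_app g u v"
proof
  show "metric_app g (f *\<^sub>F u) v p = (f * metric_app g u v) p" for p
    using metric_linear_left[OF sections_fibre[OF assms(2)], of p] assms(1)[THEN sections_fibre]
    unfolding metric_app_def linear_on_set_def fmult_def times_fun_def by auto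
qed

lemma metric_app_add_right:
  assumes "u \<in> sections A E" "v \<in> sections A E" "v' \<in> sections A E"
  shows "metric_app g u (v + v') = metric_app g u v + metric_app g u v'"
  using assms by (simp add: metric_app_sym[OF assms(1)] metric_app_add_left sections_add)

lemma metric_app_fmult_right:
  assumes "u \<in> sections A E" "v \<in> sections A E" "f \<in> Cinf A"
  shows "metric_app g u (f *\<^sub>F v) = f * metric_app g u v"
  using assms by (simp add: metric_app_sym[OF assms(1)] metric_app_fmult_left sections_fmult)

text \<open>Nondegeneracy speaks of fibre vectors; each of them is the value of a global section, so
  testing on global sections is enough.\<close>

lemma metric_eqI_fibre:
  assumes "v \<in> fibre E p" "v' \<in> fibre E p" "\<And>w. w \<in> sections A E \<Longrightarrow> g p v (w p) = g p v' (w p)"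
  shows "v = v'"
proof -
  have "v - v' = 0"
  proof (rule metric_nondegenerate[of _ p])
    show "v - v' \<in> fibre E p" using assms(1,2) by (rule subspace_diff[OF fibre_subspace])
    fix w assume w: "w \<in> fibre E p"
    obtain s where s: "s \<in> sections A E" "s p = w" using section_through[OF w] .
    have "g p v w = g p (v' + (v - v')) w" by simp
    also have "\<dots> = g p v' w + g p (v - v') w"
      using metric_linear_left[OF w] assms(1,2) subspace_diff[OF fibre_subspace]
      unfolding linear_on_set_def by blast
    finally show "g p (v - v') w = 0"
      using assms(3)[OF s(1)] s(2) by simp
  qed
  then show ?thesis by simp
qed

lemma metric_eqI:
  assumes "u \<in> sections A E" "v \<in> sections A E"
    "\<And>w. w \<in> sections A E \<Longrightarrow> metric_app g u w = metric_app g v w"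
  shows "u = v"
proof
  fix p
  have "g p (u p) (w p) = g p (v p) (w p)" if "w \<in> sections A E" for w
    using fun_cong[OF assms(3)[OF that], of p] by (simp add: metric_app_def)
  then show "u p = v p"
    by (rule metric_eqI_fibre[OF sections_fibre[OF assms(1)] sections_fibre[OF assms(2)]])
qed

text \<open>On a frame the condition is a linear system whose matrix is the Gram matrix of g.
  Nondegeneracy makes it invertible, and Cramer's rule gives coefficients that are smooth in q.
  Linearity then carries the equation from the frame to every w.\<close>

lemma raise_index_local:
  assumes H: "Cinf_linear_on A (sections A E) H" and HC: "\<And>w. w \<in> sections A E \<Longrightarrow> H w \<in> Cinf A"
  obtains W t where "open W" "p \<in> W" "smooth_section_on A E W t"
    "\<forall>q\<in>W. \<forall>w\<in>sections A E. g q (t q) (w q) = H w q"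
proof -
  obtain X e where "local_frame_near A E p X e" using local_frame_exists[of p] by auto
  then obtain W where W: "open W" "p \<in> W" "\<And>q. q \<in> W \<Longrightarrow> local_frame_near A E q X e"
    by (rule local_frame_near_open) blast
  have X: "X a \<in> sections A E" if "a < rank E" for a
    using local_frame_nearD(1)[OF W(3)[OF W(2)]] that by simp
  have basis: "is_basis (fibre E q) (rank E) (\<lambda>a. X a q)" if "q \<in> W" for q
    using local_frame_nearD(3)[OF W(3)[OF that]] .
  define M where "M q b a = metric_app g (X a) (X b) q" for q b a
  define R where "R q = mat (rank E) (rank E) (\<lambda>(b, a). M q b a)" for q
  have M: "smooth_fun A W (\<lambda>q. M q b a)" if "b < rank E" "a < rank E" for a b
    using Cinf_smooth_fun[OF metric_app_Cinf[OF X X]] that by (simp add: M_def)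
  have lin: "g q (\<Sum>a<rank E. c a *\<^sub>R X a q) (X b q) = (\<Sum>a<rank E. M q b a * c a)"
    if "q \<in> W" "b < rank E" for q b c
    using linear_on_set_sum[OF metric_linear_left[OF sections_fibre[OF X[OF that(2)]]] fibre_subspace,
        of "{..<rank E}" "\<lambda>a. X a q" q c] sections_fibre[OF X]
    by (simp add: M_def metric_app_def mult_ac)
  have lin2: "g q v (\<Sum>b<rank E. k b *\<^sub>R X b q) = (\<Sum>b<rank E. k b * g q v (X b q))"
    if "q \<in> W" "v \<in> fibre E q" for q v k
    using linear_on_set_sum[OF metric_linear[OF that(2)] fibre_subspace,
        of "{..<rank E}" "\<lambda>a. X a q" k] sections_fibre[OF X] by simp
  \<comment> \<open>A kernel vector of the Gram matrix is the coefficient vector of a fibre vector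
    orthogonal to the frame, hence to the whole fibre.\<close>
  have det: "det (R q) \<noteq> 0" if q: "q \<in> W" for q
    unfolding R_def
  proof (rule det_nonzero_if_injective)
    fix c a assume c: "\<And>b. b < rank E \<Longrightarrow> (\<Sum>a<rank E. M q b a * c a) = 0" and a: "a < rank E"
    let ?v = "\<Sum>a<rank E. c a *\<^sub>R X a q"
    have v: "?v \<in> fibre E q" by (rule is_basis_combination_mem[OF basis[OF q]])
    have "?v = 0"
    proof (rule metric_nondegenerate[OF v])
      fix w assume "w \<in> fibre E q"
      then obtain k where k: "w = (\<Sum>b<rank E. k b *\<^sub>R X b q)"
        using is_basis_expansion[OF basis[OF q]] by auto
      show "g q ?v w = 0"
        unfolding k lin2[OF q v] using lin[OF q] c by simp
    qed
    then show "c a = 0"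
      using coframe_sum[of "fibre E q" "rank E" X q a c] coframe_sum[of "fibre E q" "rank E" X q a "\<lambda>_. 0"]
        basis[OF q] a by simp
  qed
  define c where "c a q = (\<Sum>d<rank E. cofactor (R q) d a * H (X d) q) * inverse (det (R q))" for a q
  define t where "t q = (\<Sum>a<rank E. c a q *\<^sub>R X a q)" for q
  have csm: "smooth_fun A W (c a)" if "a < rank E" for a
  proof -
    have "smooth_fun A W (\<lambda>q. cofactor (R q) d a)" if "d < rank E" for d
      unfolding R_def using \<open>a < rank E\<close> that by (intro smooth_fun_cofactor[OF W(1)] M)
    moreover have "smooth_fun A W (\<lambda>q. det (R q))"
      unfolding R_def by (intro smooth_fun_det[OF W(1)] M)
    moreover have "smooth_fun A W (H (X d))" if "d < rank E" for d
      by (rule Cinf_smooth_fun[OF HC[OF X[OF that]]])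
    ultimately show ?thesis
      unfolding c_def[abs_def] using det
      by (intro smooth_fun_mult[OF W(1)] smooth_fun_sum[OF W(1)] smooth_fun_inverse[OF W(1)]) auto
  qed
  have "smooth_section_on A E W t"
    unfolding t_def[abs_def] using csm X
    by (intro section_on_sum[OF W(1)] section_on_scale[OF W(1)])
      (auto simp: sections_iff intro: section_on_subset[of UNIV])
  moreover have "g q (t q) (w q) = H w q" if q: "q \<in> W" and w: "w \<in> sections A E" for q w
  proof -
    obtain k where k: "w q = (\<Sum>b<rank E. k b *\<^sub>R X b q)"
      using is_basis_expansion[OF basis[OF q] sections_fibre[OF w]] .
    have tq: "t q \<in> fibre E q"
      unfolding t_def by (rule is_basis_combination_mem[OF basis[OF q]])
    have "g q (t q) (X b q) = H (X b) q" if b: "b < rank E" for b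
    proof -
      have "g q (t q) (X b q) = (\<Sum>a<rank E. M q b a * c a q)"
        unfolding t_def by (rule lin[OF q b])
      also have "\<dots> = H (X b) q"
        using adj_mat_solves[of "rank E" "M q" b "\<lambda>d. H (X d) q"] det[OF q] b
        by (simp add: c_def R_def)
      finally show ?thesis .
    qed
    then have "g q (t q) (w q) = (\<Sum>b<rank E. k b * H (X b) q)"
      unfolding k lin2[OF q tq] by simp
    \<comment> \<open>The combination with the constants k_b agrees with w at q only;
      \<open>H\<close> does not see the difference at q.\<close>
    also have "\<dots> = H (\<lambda>q. \<Sum>b<rank E. k b *\<^sub>R X b q) q"
      by (subst Cinf_linear_combination[OF H, where f = "\<lambda>b q. k b"]) (use X Cinf_const in auto)
    also have "\<dots> = H w q"
      using k by (intro Cinf_linear_pointwise[OF H] sections_combination[where f = "\<lambda>b q. k b"] w)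
        (use X Cinf_const in auto)
    finally show ?thesis .
  qed
  ultimately show ?thesis using that[OF W(1,2)] by simp
qed

text \<open>The solution vector at each point is unique by nondegeneracy, so the pointwise choice
  coincides with the smooth local solutions and needs no gluing.\<close>

lemma raise_index:
  assumes H: "Cinf_linear_on A (sections A E) H" and HC: "\<And>w. w \<in> sections A E \<Longrightarrow> H w \<in> Cinf A"
  obtains s where "s \<in> sections A E" "\<forall>w\<in>sections A E. metric_app g s w = H w"
proof -
  have "\<exists>v. v \<in> fibre E p \<and> (\<forall>w\<in>sections A E. g p v (w p) = H w p)" for p
  proof -
    obtain W t where W: "open W" "p \<in> W" and t: "smooth_section_on A E W t"
      and eq: "\<forall>q\<in>W. \<forall>w\<in>sections A E. g q (t q) (w q) = H w q"
      by (rule raise_index_local[OF H HC, of p])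
    have "t p \<in> fibre E p \<and> (\<forall>w\<in>sections A E. g p (t p) (w p) = H w p)"
      using eq W(2) smooth_section_on_fibre[OF t W(2)] by simp
    then show ?thesis by (rule exI)
  qed
  then obtain s where s: "\<And>p. s p \<in> fibre E p" "\<And>p w. w \<in> sections A E \<Longrightarrow> g p (s p) (w p) = H w p"
    by metis
  have "smooth_section_on A E UNIV s"
  proof (rule section_on_local)
    fix p :: 'm
    obtain W t where W: "open W" "p \<in> W" and t: "smooth_section_on A E W t"
      and eq: "\<forall>q\<in>W. \<forall>w\<in>sections A E. g q (t q) (w q) = H w q"
      by (rule raise_index_local[OF H HC, of p])
    have "t q = s q" if "q \<in> W" for q
      using eq that s smooth_section_on_fibre[OF t that] by (intro metric_eqI_fibre[of _ q]) auto
    then have "smooth_section_on A E W s"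
      by (rule section_on_cong[OF t W(1)])
    then show "\<exists>V. open V \<and> p \<in> V \<and> smooth_section_on A E V s"
      using W by auto
  qed simp
  then show ?thesis
    using that[of s] s(2) by (auto simp: sections_iff metric_app_def)
qed

end


section \<open>Algebra of sections\<close>

lemma fmult_add: "f *\<^sub>F (s + t) = f *\<^sub>F s + f *\<^sub>F t"
  by (simp add: fmult_def plus_fun_def scaleR_add_right)

lemma fmult_diff: "f *\<^sub>F (s - t) = f *\<^sub>F s - f *\<^sub>F t"
  by (simp add: fmult_def fun_diff_def scaleR_diff_right)

lemma fmult_uminus: "f *\<^sub>F (- s) = - (f *\<^sub>F s)"
  by (simp add: fmult_def fun_Compl_def)

lemma fmult_apply: "(f *\<^sub>F s) p = f p *\<^sub>R s p"
  by (simp add: fmult_def)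

lemma scaleR_fun_apply: "(c *\<^sub>R s) p = c *\<^sub>R s p"
  by (simp add: scaleR_fun_def)

lemma fmult_const: "(\<lambda>p. c) *\<^sub>F s = c *\<^sub>R s"
  by (simp add: fmult_def scaleR_fun_def)

lemma fmult_real: "f *\<^sub>F h = f * (h :: 'm \<Rightarrow> real)"
  by (simp add: fmult_def times_fun_def)

lemma scaleR_fun_mult: "c *\<^sub>R (f * h) = f * (c *\<^sub>R h)" for f h :: "'m \<Rightarrow> real"
  by (simp add: scaleR_fun_def times_fun_def mult.left_commute)

locale connection_bundle = anchored_bundle A E \<rho>
  for A :: "('m::{t2_space,second_countable_topology}, 'n::real_inner) chart set"
    and E :: "('m, 'f::real_vector) vbundle"
    and \<rho> :: "('m, 'f) anchor" +
  fixes D :: "('m, 'f) secop"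
  assumes connection: "E_connection A E \<rho> D"
begin

abbreviation S where "S \<equiv> sections A E"

lemma connection_closed: "u \<in> S \<Longrightarrow> v \<in> S \<Longrightarrow> D u v \<in> S"
  using PiE_mem[OF PiE_mem[OF connection[unfolded E_connection_def, THEN conjunct1]]] .

lemma connection_add_right: "u \<in> S \<Longrightarrow> v \<in> S \<Longrightarrow> w \<in> S \<Longrightarrow> D u (v + w) = D u v + D u w"
  and connection_add_left: "u \<in> S \<Longrightarrow> v \<in> S \<Longrightarrow> w \<in> S \<Longrightarrow> D (u + v) w = D u w + D v w"
  using connection unfolding E_connection_def real_bilinear_on_def linear_on_set_def by auto

lemma connection_scale_right: "u \<in> S \<Longrightarrow> v \<in> S \<Longrightarrow> D u (c *\<^sub>R v) = c *\<^sub>R D u v"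
  using connection unfolding E_connection_def real_bilinear_on_def linear_on_set_def by auto

lemma connection_leibniz:
  "u \<in> S \<Longrightarrow> v \<in> S \<Longrightarrow> f \<in> Cinf A \<Longrightarrow> D u (f *\<^sub>F v) = anchor_app \<rho> u f *\<^sub>F v + f *\<^sub>F D u v"
  and connection_fmult_left: "u \<in> S \<Longrightarrow> v \<in> S \<Longrightarrow> f \<in> Cinf A \<Longrightarrow> D (f *\<^sub>F u) v = f *\<^sub>F D u v"
  using connection unfolding E_connection_def by auto

end


section \<open>The modified bracket\<close>

locale local_algebroid = connection_bundle A E \<rho> D
  for A :: "('m::{t2_space,second_countable_topology}, 'n::real_inner) chart set"
    and E :: "('m, 'f::real_vector) vbundle"
    and \<rho> :: "('m, 'f) anchor"
    and D :: "('m, 'f) secop" +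
  fixes br :: "('m, 'f) secop" and L :: "('m, 'f) locop"
  assumes algebroid: "local_almost_leibniz_algebroid A E \<rho> br L"
begin

abbreviation S' where "S' \<equiv> sections A (dual_bundle E)"

lemma locality_closed: "\<alpha> \<in> S' \<Longrightarrow> u \<in> S \<Longrightarrow> v \<in> S \<Longrightarrow> L \<alpha> u v \<in> S"
  using algebroid unfolding local_almost_leibniz_algebroid_def by auto

lemma
  shows locality_linear1: "u \<in> S \<Longrightarrow> v \<in> S \<Longrightarrow> Cinf_linear_on A S' (\<lambda>\<alpha>. L \<alpha> u v)"
    and locality_linear2: "\<alpha> \<in> S' \<Longrightarrow> v \<in> S \<Longrightarrow> Cinf_linear_on A S (\<lambda>u. L \<alpha> u v)"
    and locality_linear3: "\<alpha> \<in> S' \<Longrightarrow> u \<in> S \<Longrightarrow> Cinf_linear_on A S (\<lambda>v. L \<alpha> u v)"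
  using algebroid unfolding local_almost_leibniz_algebroid_def by auto

lemma locality_scale2: "\<alpha> \<in> S' \<Longrightarrow> u \<in> S \<Longrightarrow> v \<in> S \<Longrightarrow> L \<alpha> (c *\<^sub>R u) v = c *\<^sub>R L \<alpha> u v"
  using locality_linear2[of \<alpha> v] Cinf_const[of c] unfolding Cinf_linear_on_def
  by (auto simp flip: fmult_const)

lemma bracket: "almost_leibniz_algebroid A E \<rho> br"
  using algebroid by (simp add: local_almost_leibniz_algebroid_def)

text \<open>L(\<alpha>, D_x u, v) is linear over smooth functions in both \<alpha> and x, because
  \<open>D\<close> is so in its direction. Frame independence thus replaces the frame chosen at p by
  any given one.\<close>

lemma loc_term_eq:
  assumes F: "local_frame_near A E p X e" and u: "u \<in> S" and v: "v \<in> S"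
  shows "loc_term A E L D u v p = (\<Sum>a<rank E. L (e a) (D (X a) u) v p)"
proof -
  define Xe where "Xe = (SOME (X, e). local_frame_near A E p X e)"
  have "case Xe of (X, e) \<Rightarrow> local_frame_near A E p X e"
    unfolding Xe_def by (rule someI[of _ "(X, e)"]) (simp add: F)
  then have F': "local_frame_near A E p (fst Xe) (snd Xe)"
    by (simp add: case_prod_beta)
  have "loc_term A E L D u v p = (\<Sum>a<rank E. L (snd Xe a) (D (fst Xe a) u) v p)"
    unfolding loc_term_def Xe_def[symmetric] by (simp add: Let_def case_prod_beta)
  also have "\<dots> = (\<Sum>a<rank E. L (e a) (D (X a) u) v p)"
  proof (rule contraction_frame_independent[where B = "\<lambda>\<alpha> x. L \<alpha> (D x u) v", OF _ _ F' F])
    show "Cinf_linear_on A S' (\<lambda>\<alpha>. L \<alpha> (D x u) v)" if "x \<in> S" for x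
      using locality_linear1[OF connection_closed[OF that u] v] .
    show "Cinf_linear_on A S (\<lambda>x. L \<alpha> (D x u) v)" if "\<alpha> \<in> S'" for \<alpha>
      using locality_linear2[OF that v] u connection_closed
      by (simp add: Cinf_linear_on_def connection_add_left connection_fmult_left)
  qed
  finally show ?thesis .
qed

text \<open>Near each point one fixed frame computes \<open>loc_term\<close> on a whole
  neighbourhood, which exhibits it there as a finite sum of global sections.\<close>

lemma loc_term_section:
  assumes "u \<in> S" "v \<in> S"
  shows "loc_term A E L D u v \<in> S"
  unfolding sections_iff
proof (rule section_on_local)
  fix p :: 'm
  obtain X e where F: "local_frame_near A E p X e" using local_frame_exists[of p] by auto
  obtain W where W: "open W" "p \<in> W" "\<And>q. q \<in> W \<Longrightarrow> local_frame_near A E q X e"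
    by (rule local_frame_near_open[OF F]) blast
  have "smooth_section_on A E W (\<lambda>q. \<Sum>a<rank E. L (e a) (D (X a) u) v q)"
  proof (rule section_on_sum[OF W(1)])
    fix a assume "a \<in> {..<rank E}"
    then have "L (e a) (D (X a) u) v \<in> S"
      using local_frame_nearD(1,2)[OF F] assms by (intro locality_closed connection_closed) auto
    then show "smooth_section_on A E W (L (e a) (D (X a) u) v)"
      unfolding sections_iff by (rule section_on_subset) simp
  qed
  then have "smooth_section_on A E W (loc_term A E L D u v)"
    by (rule section_on_cong[OF _ W(1)]) (simp add: loc_term_eq[OF W(3) assms])
  then show "\<exists>V. open V \<and> p \<in> V \<and> smooth_section_on A E V (loc_term A E L D u v)"
    using W(1,2) by auto
qed simp

lemma loc_term_eqI:
  assumes "\<And>p X e. local_frame_near A E p X e \<Longrightarrow> s p = t p"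
  shows "s = t"
proof
  fix p
  show "s p = t p" using local_frame_exists[of p] assms by auto
qed

lemma loc_term_add_left:
  assumes "u \<in> S" "u' \<in> S" "v \<in> S"
  shows "loc_term A E L D (u + u') v = loc_term A E L D u v + loc_term A E L D u' v"
proof (rule loc_term_eqI)
  fix p X e assume F: "local_frame_near A E p X e"
  have "L (e a) (D (X a) (u + u')) v = L (e a) (D (X a) u) v + L (e a) (D (X a) u') v" if "a < rank E" for a
    using locality_linear2[of "e a" v] local_frame_nearD(1,2)[OF F that] assms connection_closed
    by (simp add: Cinf_linear_on_def connection_add_right)
  then show "loc_term A E L D (u + u') v p = (loc_term A E L D u v + loc_term A E L D u' v) p"
    by (simp add: loc_term_eq[OF F] assms sections_add sum.distrib)
qed

text \<open>Only real factors come out: \<open>D (X a)\<close> is a derivation, so a function in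
  front of \<open>u\<close> would also be differentiated.\<close>

lemma loc_term_scale_left:
  assumes "u \<in> S" "v \<in> S"
  shows "loc_term A E L D (c *\<^sub>R u) v = c *\<^sub>R loc_term A E L D u v"
proof (rule loc_term_eqI)
  fix p X e assume F: "local_frame_near A E p X e"
  have "L (e a) (D (X a) (c *\<^sub>R u)) v = c *\<^sub>R L (e a) (D (X a) u) v" if "a < rank E" for a
    using local_frame_nearD(1,2)[OF F that] assms
    by (simp add: connection_scale_right locality_scale2 connection_closed)
  then show "loc_term A E L D (c *\<^sub>R u) v p = (c *\<^sub>R loc_term A E L D u v) p"
    by (simp add: loc_term_eq[OF F] assms sections_scale scaleR_fun_apply scaleR_sum_right)
qed

lemma loc_term_add_right:
  assumes "u \<in> S" "v \<in> S" "v' \<in> S"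
  shows "loc_term A E L D u (v + v') = loc_term A E L D u v + loc_term A E L D u v'"
proof (rule loc_term_eqI)
  fix p X e assume F: "local_frame_near A E p X e"
  have "L (e a) (D (X a) u) (v + v') = L (e a) (D (X a) u) v + L (e a) (D (X a) u) v'" if "a < rank E" for a
    using locality_linear3[of "e a" "D (X a) u"] local_frame_nearD(1,2)[OF F that] assms connection_closed
    by (simp add: Cinf_linear_on_def)
  then show "loc_term A E L D u (v + v') p = (loc_term A E L D u v + loc_term A E L D u v') p"
    by (simp add: loc_term_eq[OF F] assms sections_add sum.distrib)
qed

lemma loc_term_fmult_right:
  assumes "u \<in> S" "v \<in> S" "f \<in> Cinf A"
  shows "loc_term A E L D u (f *\<^sub>F v) = f *\<^sub>F loc_term A E L D u v"
proof (rule loc_term_eqI)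
  fix p X e assume F: "local_frame_near A E p X e"
  have "L (e a) (D (X a) u) (f *\<^sub>F v) = f *\<^sub>F L (e a) (D (X a) u) v" if "a < rank E" for a
    using locality_linear3[of "e a" "D (X a) u"] local_frame_nearD(1,2)[OF F that] assms connection_closed
    by (simp add: Cinf_linear_on_def)
  then show "loc_term A E L D u (f *\<^sub>F v) p = (f *\<^sub>F loc_term A E L D u v) p"
    by (simp add: loc_term_eq[OF F] assms sections_fmult fmult_apply scaleR_sum_right)
qed

text \<open>Admissibility is anti-symmetry of the modified bracket, rearranged. The right Leibniz
  rule survives because the subtracted term is linear over smooth functions in its right
  argument.\<close>

lemma modified_bracket_almost_lie:
  assumes adm: "admissible A E br L D"
  shows "almost_lie_algebroid A E \<rho> (modified_bracket A E br L D)"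
proof -
  let ?b = "modified_bracket A E br L D"
  have br: "br u v \<in> S" "br u (v + w) = br u v + br u w" "br (u + v) w = br u w + br v w"
    "br u (c *\<^sub>R v) = c *\<^sub>R br u v" "br (c *\<^sub>R u) v = c *\<^sub>R br u v"
    "f \<in> Cinf A \<Longrightarrow> br u (f *\<^sub>F v) = anchor_app \<rho> u f *\<^sub>F v + f *\<^sub>F br u v"
    if "u \<in> S" "v \<in> S" "w \<in> S" for u v w c f
    using bracket that
    unfolding almost_leibniz_algebroid_def real_bilinear_on_def linear_on_set_def by auto
  have anti: "?b u v = - ?b v u" if "u \<in> S" "v \<in> S" for u v
  proof -
    have "br u v + br v u = loc_term A E L D u v + loc_term A E L D v u"
      using adm that by (simp add: admissible_def)
    then show ?thesis
      unfolding modified_bracket_def by (simp add: algebra_simps)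
  qed
  have closed: "?b u v \<in> S" if "u \<in> S" "v \<in> S" for u v
    unfolding modified_bracket_def using that br(1) loc_term_section by (intro sections_diff) auto
  have addr: "?b u (v + w) = ?b u v + ?b u w" if "u \<in> S" "v \<in> S" "w \<in> S" for u v w
    unfolding modified_bracket_def using that by (simp add: br(2) loc_term_add_right)
  have addl: "?b (u + v) w = ?b u w + ?b v w" if "u \<in> S" "v \<in> S" "w \<in> S" for u v w
    unfolding modified_bracket_def using that by (simp add: br(3) loc_term_add_left)
  have scalel: "?b (c *\<^sub>R u) v = c *\<^sub>R ?b u v" if "u \<in> S" "v \<in> S" for u v c
    unfolding modified_bracket_def using that br(5)[OF that that(1)]
    by (simp add: loc_term_scale_left scaleR_diff_right)
  have scaler: "?b u (c *\<^sub>R v) = c *\<^sub>R ?b u v" if "u \<in> S" "v \<in> S" for u v c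
    using anti[of u "c *\<^sub>R v"] anti[of u v] scalel[of v u c] that sections_scale by simp
  have leibniz: "?b u (f *\<^sub>F v) = anchor_app \<rho> u f *\<^sub>F v + f *\<^sub>F ?b u v"
    if "u \<in> S" "v \<in> S" "f \<in> Cinf A" for u v f
    unfolding modified_bracket_def using that br(6)[OF that(1,2,1,3)]
    by (simp add: loc_term_fmult_right fmult_diff)
  have leib: "almost_leibniz_algebroid A E \<rho> ?b"
    unfolding almost_leibniz_algebroid_def real_bilinear_on_def linear_on_set_def
    by (simp add: Pi_iff anchor closed addr addl scalel scaler leibniz)
  show ?thesis
    unfolding almost_lie_algebroid_def by (intro conjI ballI leib anti)
qed

end


section \<open>The Levi-Civita connection\<close>

text \<open>The bracket \<open>b\<close> is any almost-Lie bracket. Taking the modified bracket for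
  \<open>b\<close> later turns \<open>torsion\<close> into the torsion of \<open>D\<close> in the
  sense of \<open>E_torsion\<close>.\<close>

locale metric_connection =
  connection_bundle A E \<rho> D + metric_bundle A E g
  for A :: "('m::{t2_space,second_countable_topology}, 'n::real_inner) chart set"
    and E :: "('m, 'f::real_vector) vbundle"
    and \<rho> :: "('m, 'f) anchor"
    and D :: "('m, 'f) secop"
    and g :: "'m \<Rightarrow> 'f \<Rightarrow> 'f \<Rightarrow> real" +
  fixes b :: "('m, 'f) secop"
  assumes lie: "almost_lie_algebroid A E \<rho> b"
begin

abbreviation G where "G \<equiv> metric_app g"

abbreviation Q where "Q \<equiv> E_nonmetricity \<rho> D g"

definition torsion :: "('m, 'f) secop" where
  "torsion u v = D u v - D v u - b u v"

text \<open>Twice the metric pairing of (Levi-Civita minus \<open>D\<close>)(u,v) with w: the Koszul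
  computation carried out with the defects Q and T of \<open>D\<close> in place of its anchor and
  bracket terms.\<close>

definition contorsion_form :: "('m, 'f) sec \<Rightarrow> ('m, 'f) sec \<Rightarrow> ('m, 'f) sec \<Rightarrow> 'm \<Rightarrow> real" where
  "contorsion_form u v w = Q u v w + Q v u w - Q w u v
     + G (torsion v w) u + G (torsion u w) v - G (torsion u v) w"

lemma bracket_anti: "u \<in> S \<Longrightarrow> v \<in> S \<Longrightarrow> b u v = - b v u"
  using lie unfolding almost_lie_algebroid_def by blast

lemma bracket_closed: "u \<in> S \<Longrightarrow> v \<in> S \<Longrightarrow> b u v \<in> S"
  and bracket_add_left: "u \<in> S \<Longrightarrow> v \<in> S \<Longrightarrow> w \<in> S \<Longrightarrow> b (u + v) w = b u w + b v w"
  and bracket_leibniz: "u \<in> S \<Longrightarrow> v \<in> S \<Longrightarrow> f \<in> Cinf A \<Longrightarrow>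
    b u (f *\<^sub>F v) = anchor_app \<rho> u f *\<^sub>F v + f *\<^sub>F b u v"
  using lie[unfolded almost_lie_algebroid_def, THEN conjunct1]
  unfolding almost_leibniz_algebroid_def real_bilinear_on_def linear_on_set_def
  by auto

lemma metric_app_diff_left:
  assumes "u \<in> S" "u' \<in> S" "v \<in> S"
  shows "G (u - u') v = G u v - G u' v"
  using metric_app_add_left[of "u - u'" u' v] assms sections_diff by simp

lemma metric_app_uminus_left:
  assumes "u \<in> S" "v \<in> S"
  shows "G (- u) v = - G u v"
  using metric_app_diff_left[of 0 u v] metric_app_add_left[of 0 0 v] assms sections_zero by simp

section \<open>Torsion and non-metricity as tensors\<close>

lemma torsion_closed: "u \<in> S \<Longrightarrow> v \<in> S \<Longrightarrow> torsion u v \<in> S"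
  unfolding torsion_def by (intro sections_diff connection_closed bracket_closed)

lemma torsion_anti: "u \<in> S \<Longrightarrow> v \<in> S \<Longrightarrow> torsion u v = - torsion v u"
  unfolding torsion_def by (simp add: bracket_anti[of u v])

lemma torsion_add_left:
  "u \<in> S \<Longrightarrow> u' \<in> S \<Longrightarrow> v \<in> S \<Longrightarrow> torsion (u + u') v = torsion u v + torsion u' v"
  unfolding torsion_def by (simp add: connection_add_left connection_add_right bracket_add_left)

text \<open>Anti-symmetry turns the right Leibniz rule of \<open>b\<close> into a left one, whose
  term \<rho>(v)(f) u cancels that of \<open>D v (f *\<^sub>F u)\<close>.\<close>

lemma torsion_fmult_left:
  assumes "u \<in> S" "v \<in> S" "f \<in> Cinf A"
  shows "torsion (f *\<^sub>F u) v = f *\<^sub>F torsion u v"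
proof -
  have "b (f *\<^sub>F u) v = - (anchor_app \<rho> v f *\<^sub>F u) + f *\<^sub>F b u v"
    using bracket_anti[of "f *\<^sub>F u" v] bracket_leibniz[of v u f] bracket_anti[of u v] assms
    by (simp add: sections_fmult fmult_uminus)
  then show ?thesis
    unfolding torsion_def using assms
    by (simp add: connection_fmult_left connection_leibniz fmult_diff)
qed

lemma torsion_add_right:
  assumes "u \<in> S" "v \<in> S" "v' \<in> S"
  shows "torsion u (v + v') = torsion u v + torsion u v'"
  using torsion_anti[of u "v + v'"] torsion_anti[of u v] torsion_anti[of u v'] torsion_add_left[of v v' u]
    assms sections_add by simp

lemma torsion_fmult_right:
  assumes "u \<in> S" "v \<in> S" "f \<in> Cinf A"
  shows "torsion u (f *\<^sub>F v) = f *\<^sub>F torsion u v"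
  using torsion_anti[of u "f *\<^sub>F v"] torsion_anti[of u v] torsion_fmult_left[of v u f] assms sections_fmult
  by (simp add: fmult_uminus)

lemma nonmetricity_sym:
  "u \<in> S \<Longrightarrow> v \<in> S \<Longrightarrow> w \<in> S \<Longrightarrow> Q u v w = Q u w v"
  unfolding E_nonmetricity_def
  by (simp add: metric_app_sym[of v w] metric_app_sym[of "D u v" w] metric_app_sym[of v "D u w"]
      connection_closed)

lemma nonmetricity_Cinf: "u \<in> S \<Longrightarrow> v \<in> S \<Longrightarrow> w \<in> S \<Longrightarrow> Q u v w \<in> Cinf A"
  unfolding E_nonmetricity_def
  by (intro Cinf_diff anchor_app_Cinf metric_app_Cinf connection_closed)

lemma nonmetricity_add1:
  "u \<in> S \<Longrightarrow> u' \<in> S \<Longrightarrow> v \<in> S \<Longrightarrow> w \<in> S \<Longrightarrow> Q (u + u') v w = Q u v w + Q u' v w"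
  unfolding E_nonmetricity_def
  by (simp add: anchor_app_add_left connection_add_left metric_app_add_left metric_app_add_right
      connection_closed)

lemma nonmetricity_fmult1:
  "u \<in> S \<Longrightarrow> v \<in> S \<Longrightarrow> w \<in> S \<Longrightarrow> f \<in> Cinf A \<Longrightarrow> Q (f *\<^sub>F u) v w = f * Q u v w"
  unfolding E_nonmetricity_def
  by (simp add: anchor_app_fmult_left connection_fmult_left metric_app_fmult_left metric_app_fmult_right
      connection_closed algebra_simps)

lemma nonmetricity_add3:
  "u \<in> S \<Longrightarrow> v \<in> S \<Longrightarrow> w \<in> S \<Longrightarrow> w' \<in> S \<Longrightarrow> Q u v (w + w') = Q u v w + Q u v w'"
  unfolding E_nonmetricity_def
  by (simp add: anchor_app_add connection_add_right metric_app_add_right metric_app_Cinf connection_closed)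

text \<open>The term \<rho>(u)(f) g(v,w) arises twice, from the derivation property of the anchor
  and from the Leibniz rule of \<open>D\<close>, with opposite signs.\<close>

lemma nonmetricity_fmult3:
  "u \<in> S \<Longrightarrow> v \<in> S \<Longrightarrow> w \<in> S \<Longrightarrow> f \<in> Cinf A \<Longrightarrow> Q u v (f *\<^sub>F w) = f * Q u v w"
  unfolding E_nonmetricity_def
  by (simp add: anchor_app_mult connection_leibniz metric_app_add_right metric_app_fmult_right
      metric_app_Cinf connection_closed anchor_app_Cinf sections_fmult algebra_simps)

lemma nonmetricity_add2:
  "u \<in> S \<Longrightarrow> v \<in> S \<Longrightarrow> v' \<in> S \<Longrightarrow> w \<in> S \<Longrightarrow> Q u (v + v') w = Q u v w + Q u v' w"
  using nonmetricity_sym[of u "v + v'" w] nonmetricity_sym[of u w v] nonmetricity_sym[of u w v']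
  by (simp add: nonmetricity_add3 sections_add)

lemma nonmetricity_fmult2:
  "u \<in> S \<Longrightarrow> v \<in> S \<Longrightarrow> w \<in> S \<Longrightarrow> f \<in> Cinf A \<Longrightarrow> Q u (f *\<^sub>F v) w = f * Q u v w"
  using nonmetricity_sym[of u "f *\<^sub>F v" w] nonmetricity_sym[of u w v]
  by (simp add: nonmetricity_fmult3 sections_fmult)

lemmas tensor_simps =
  nonmetricity_add1 nonmetricity_add2 nonmetricity_add3
  nonmetricity_fmult1 nonmetricity_fmult2 nonmetricity_fmult3
  torsion_add_left torsion_add_right torsion_fmult_left torsion_fmult_right torsion_closed
  metric_app_add_left metric_app_add_right metric_app_fmult_left metric_app_fmult_right

section \<open>The contorsion form: tensoriality and symmetries\<close>

lemma contorsion_form_Cinf: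
  "u \<in> S \<Longrightarrow> v \<in> S \<Longrightarrow> w \<in> S \<Longrightarrow> contorsion_form u v w \<in> Cinf A"
  unfolding contorsion_form_def
  by (intro Cinf_diff Cinf_add nonmetricity_Cinf metric_app_Cinf torsion_closed)

lemma contorsion_form_add1:
  "u \<in> S \<Longrightarrow> u' \<in> S \<Longrightarrow> v \<in> S \<Longrightarrow> w \<in> S \<Longrightarrow>
    contorsion_form (u + u') v w = contorsion_form u v w + contorsion_form u' v w"
  and contorsion_form_add2: "u \<in> S \<Longrightarrow> v \<in> S \<Longrightarrow> v' \<in> S \<Longrightarrow> w \<in> S \<Longrightarrow>
    contorsion_form u (v + v') w = contorsion_form u v w + contorsion_form u v' w"
  and contorsion_form_add3: "u \<in> S \<Longrightarrow> v \<in> S \<Longrightarrow> w \<in> S \<Longrightarrow> w' \<in> S \<Longrightarrow>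
    contorsion_form u v (w + w') = contorsion_form u v w + contorsion_form u v w'"
  unfolding contorsion_form_def by (simp_all add: tensor_simps)

lemma contorsion_form_fmult1: "u \<in> S \<Longrightarrow> v \<in> S \<Longrightarrow> w \<in> S \<Longrightarrow> f \<in> Cinf A \<Longrightarrow>
    contorsion_form (f *\<^sub>F u) v w = f * contorsion_form u v w"
  and contorsion_form_fmult2: "u \<in> S \<Longrightarrow> v \<in> S \<Longrightarrow> w \<in> S \<Longrightarrow> f \<in> Cinf A \<Longrightarrow>
    contorsion_form u (f *\<^sub>F v) w = f * contorsion_form u v w"
  and contorsion_form_fmult3: "u \<in> S \<Longrightarrow> v \<in> S \<Longrightarrow> w \<in> S \<Longrightarrow> f \<in> Cinf A \<Longrightarrow>
    contorsion_form u v (f *\<^sub>F w) = f * contorsion_form u v w"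
  unfolding contorsion_form_def by (simp_all add: tensor_simps algebra_simps)

text \<open>All terms but the last are symmetric in u and v. This identity makes the corrected
  connection torsion-free.\<close>

lemma contorsion_form_swap12:
  assumes "u \<in> S" "v \<in> S" "w \<in> S"
  shows "contorsion_form u v w - contorsion_form v u w = - (2 *\<^sub>R G (torsion u v) w)"
proof -
  have "Q w v u = Q w u v" using nonmetricity_sym assms by simp
  moreover have "G (torsion v u) w = - G (torsion u v) w"
    using torsion_anti[of v u] metric_app_uminus_left[OF torsion_closed[of u v]] assms by simp
  ultimately show ?thesis
    unfolding contorsion_form_def by (simp add: scaleR_2 algebra_simps)
qed

text \<open>Everything except Q(u,v,w) changes sign when v and w are exchanged. This identity makes
  the corrected connection metric.\<close>

lemma contorsion_form_swap23:
  assumes "u \<in> S" "v \<in> S" "w \<in> S"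
  shows "contorsion_form u v w + contorsion_form u w v = 2 *\<^sub>R Q u v w"
proof -
  have "Q u w v = Q u v w" "Q w v u = Q w u v" "Q v w u = Q v u w"
    using nonmetricity_sym assms by simp_all
  moreover have "G (torsion w v) u = - G (torsion v w) u"
    using torsion_anti[of w v] metric_app_uminus_left[OF torsion_closed[of v w]] assms by simp
  ultimately show ?thesis
    unfolding contorsion_form_def by (simp add: scaleR_2 algebra_simps)
qed

text \<open>For fixed u and v the last index of half the form is raised. The values are picked
  independently for each pair, so no algebraic law for \<open>K\<close> is available yet.\<close>

lemma contorsion_exists:
  "\<exists>K. (\<forall>u\<in>S. \<forall>v\<in>S. K u v \<in> S \<and> (\<forall>w\<in>S. 2 *\<^sub>R G (K u v) w = contorsion_form u v w))"
proof -
  have "\<exists>s. s \<in> S \<and> (\<forall>w\<in>S. 2 *\<^sub>R G s w = contorsion_form u v w)" if u: "u \<in> S" and v: "v \<in> S" for u v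
  proof -
    let ?H = "\<lambda>w. (\<lambda>p. 1/2) * contorsion_form u v w"
    have "Cinf_linear_on A S ?H"
      unfolding Cinf_linear_on_def fmult_real using u v
      by (simp add: contorsion_form_add3 contorsion_form_fmult3 algebra_simps)
    moreover have "?H w \<in> Cinf A" if "w \<in> S" for w
      using u v that by (intro Cinf_mult Cinf_const contorsion_form_Cinf)
    ultimately obtain s where s: "s \<in> S" "\<forall>w\<in>S. G s w = ?H w"
      by (rule raise_index)
    have "2 *\<^sub>R ?H w = contorsion_form u v w" for w
      by (simp add: scaleR_fun_def times_fun_def)
    then show ?thesis using s by auto
  qed
  from someI_ex[OF this] show ?thesis
    by (intro exI[of _ "\<lambda>u v. SOME s. s \<in> S \<and> (\<forall>w\<in>S. 2 *\<^sub>R G s w = contorsion_form u v w)"] ballI)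
qed

lemma levi_civita_exists:
  obtains C where "is_levi_civita A E \<rho> b g C"
    "\<forall>u\<in>S. \<forall>v\<in>S. \<forall>w\<in>S. 2 *\<^sub>R G (C u v) w = 2 *\<^sub>R G (D u v) w + contorsion_form u v w"
proof -
  obtain K where K: "\<And>u v. u \<in> S \<Longrightarrow> v \<in> S \<Longrightarrow> K u v \<in> S"
    and GK: "\<And>u v w. u \<in> S \<Longrightarrow> v \<in> S \<Longrightarrow> w \<in> S \<Longrightarrow> 2 *\<^sub>R G (K u v) w = contorsion_form u v w"
    using contorsion_exists by auto
  \<comment> \<open>Nondegeneracy recovers the laws of \<open>K\<close> from those of the form, in
    spite of the arbitrary choice.\<close>
  have eqI: "s = t" if "s \<in> S" "t \<in> S" "\<And>w. w \<in> S \<Longrightarrow> 2 *\<^sub>R G s w = 2 *\<^sub>R G t w" for s t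
  proof (rule metric_eqI[OF that(1,2)])
    show "G s w = G t w" if "w \<in> S" for w
      using \<open>\<And>w. w \<in> S \<Longrightarrow> 2 *\<^sub>R G s w = 2 *\<^sub>R G t w\<close>[OF that] by simp
  qed
  have K_add_left: "K (u + u') v = K u v + K u' v" if "u \<in> S" "u' \<in> S" "v \<in> S" for u u' v
    by (rule eqI) (use that in \<open>simp_all add: K GK sections_add metric_app_add_left scaleR_add_right
        contorsion_form_add1\<close>)
  have K_add_right: "K u (v + v') = K u v + K u v'" if "u \<in> S" "v \<in> S" "v' \<in> S" for u v v'
    by (rule eqI) (use that in \<open>simp_all add: K GK sections_add metric_app_add_left scaleR_add_right
        contorsion_form_add2\<close>)
  have K_fmult_left: "K (f *\<^sub>F u) v = f *\<^sub>F K u v" if "u \<in> S" "v \<in> S" "f \<in> Cinf A" for u v f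
    by (rule eqI) (use that in \<open>simp_all add: K GK sections_fmult metric_app_fmult_left scaleR_fun_mult
        contorsion_form_fmult1\<close>)
  have K_fmult_right: "K u (f *\<^sub>F v) = f *\<^sub>F K u v" if "u \<in> S" "v \<in> S" "f \<in> Cinf A" for u v f
    by (rule eqI) (use that in \<open>simp_all add: K GK sections_fmult metric_app_fmult_left scaleR_fun_mult
        contorsion_form_fmult2\<close>)
  \<comment> \<open>The restriction makes \<open>C\<close> extensional, as
    \<open>E_connection\<close> demands, so that uniqueness can be an equality of functions.\<close>
  define C where "C = (\<lambda>u\<in>S. \<lambda>v\<in>S. D u v + K u v)"
  have C: "C u v = D u v + K u v" if "u \<in> S" "v \<in> S" for u v
    using that by (simp add: C_def)
  have C_leibniz: "C u (f *\<^sub>F v) = anchor_app \<rho> u f *\<^sub>F v + f *\<^sub>F C u v"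
    and C_fmult_left: "C (f *\<^sub>F u) v = f *\<^sub>F C u v"
    if "u \<in> S" "v \<in> S" "f \<in> Cinf A" for u v f
    using that by (simp_all add: C sections_fmult connection_leibniz connection_fmult_left
        K_fmult_left K_fmult_right fmult_add)
  have C_scale_left: "C (c *\<^sub>R u) v = c *\<^sub>R C u v" if "u \<in> S" "v \<in> S" for u v c
    using C_fmult_left[OF that Cinf_const[of c]] by (simp add: fmult_const)
  \<comment> \<open>The Leibniz rule with a constant function would leave a term \<rho>(u)(c); real
    linearity of \<open>D\<close> avoids it.\<close>
  have C_scale_right: "C u (c *\<^sub>R v) = c *\<^sub>R C u v" if "u \<in> S" "v \<in> S" for u v c
    using that K_fmult_right[OF that Cinf_const[of c]]
    by (simp add: C sections_scale connection_scale_right fmult_const scaleR_add_right)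
  have "C \<in> S \<rightarrow>\<^sub>E S \<rightarrow>\<^sub>E S"
    unfolding C_def using K connection_closed sections_add by auto
  moreover have "real_bilinear_on S C"
    unfolding real_bilinear_on_def linear_on_set_def
    using C_scale_left C_scale_right
    by (auto simp: C sections_add connection_add_left connection_add_right K_add_left K_add_right)
  ultimately have "E_connection A E \<rho> C"
    unfolding E_connection_def using C_leibniz C_fmult_left by auto
  moreover have "C u v - C v u = b u v" if uv: "u \<in> S" "v \<in> S" for u v
  proof -
    have "K v u - K u v = torsion u v"
    proof (rule eqI)
      fix w assume w: "w \<in> S"
      have "2 *\<^sub>R G (K v u - K u v) w = - (contorsion_form u v w - contorsion_form v u w)"
        using uv w by (simp add: metric_app_diff_left K scaleR_diff_right GK)
      then show "2 *\<^sub>R G (K v u - K u v) w = 2 *\<^sub>R G (torsion u v) w"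
        using contorsion_form_swap12[OF uv w] by simp
    qed (use uv K torsion_closed sections_diff in auto)
    then show ?thesis
      using uv by (simp add: C torsion_def algebra_simps)
  qed
  moreover have "E_nonmetricity \<rho> C g u v w = 0" if uvw: "u \<in> S" "v \<in> S" "w \<in> S" for u v w
  proof -
    have "E_nonmetricity \<rho> C g u v w = Q u v w - G (K u v) w - G (K u w) v"
      unfolding E_nonmetricity_def using uvw
      by (simp add: C metric_app_add_left metric_app_add_right connection_closed K metric_app_sym[of v "K u w"])
    then have "2 *\<^sub>R E_nonmetricity \<rho> C g u v w =
        2 *\<^sub>R Q u v w - (contorsion_form u v w + contorsion_form u w v)"
      using uvw by (simp add: scaleR_diff_right GK)
    then show ?thesis
      using contorsion_form_swap23[OF uvw] by simp
  qed
  ultimately have "is_levi_civita A E \<rho> b g C"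
    by (simp add: is_levi_civita_def)
  then show ?thesis
    using that[of C] by (simp add: C metric_app_add_left connection_closed K scaleR_add_right GK)
qed

text \<open>For the difference \<open>N\<close> of two candidates, g(N(u,v),w) is symmetric in u, v
  by equal torsion and skew in v, w by equal non-metricity. Alternating the two symmetries six times
  returns to the start with a minus sign.\<close>

lemma levi_civita_unique:
  assumes C: "is_levi_civita A E \<rho> b g C" and C': "is_levi_civita A E \<rho> b g C'"
  shows "C = C'"
proof -
  have PiE: "C \<in> S \<rightarrow>\<^sub>E S \<rightarrow>\<^sub>E S" "C' \<in> S \<rightarrow>\<^sub>E S \<rightarrow>\<^sub>E S"
    using C C' by (simp_all add: is_levi_civita_def E_connection_def)
  have cl: "C u v \<in> S" "C' u v \<in> S" if "u \<in> S" "v \<in> S" for u v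
    using PiE_mem[OF PiE_mem[OF PiE(1)]] PiE_mem[OF PiE_mem[OF PiE(2)]] that by simp_all
  define N where "N u v = C u v - C' u v" for u v
  have N: "N u v \<in> S" if "u \<in> S" "v \<in> S" for u v
    unfolding N_def using cl[OF that] by (rule sections_diff)
  have sym: "N u v = N v u" if "u \<in> S" "v \<in> S" for u v
  proof -
    have "C u v - C v u = C' u v - C' v u"
      using C C' that by (simp add: is_levi_civita_def)
    then show ?thesis by (simp add: N_def algebra_simps)
  qed
  have skew: "G (N u v) w = - G (N u w) v" if "u \<in> S" "v \<in> S" "w \<in> S" for u v w
  proof -
    have "E_nonmetricity \<rho> C g u v w = E_nonmetricity \<rho> C' g u v w"
      using C C' that by (simp add: is_levi_civita_def)
    then have "G (C u v) w + G (C u w) v = G (C' u v) w + G (C' u w) v"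
      unfolding E_nonmetricity_def using that cl
      by (simp add: metric_app_sym[of v "C u w"] metric_app_sym[of v "C' u w"] algebra_simps)
    then show ?thesis
      using that cl by (simp add: N_def metric_app_diff_left algebra_simps)
  qed
  have "C u v = C' u v" if uv: "u \<in> S" "v \<in> S" for u v
  proof (rule metric_eqI[OF cl[OF uv]])
    fix w assume w: "w \<in> S"
    have "G (N u v) w = G (N v u) w" by (simp only: sym[OF uv])
    also have "\<dots> = - G (N v w) u" by (rule skew[OF uv(2,1) w])
    also have "\<dots> = - G (N w v) u" by (simp only: sym[OF uv(2) w])
    also have "\<dots> = G (N w u) v" by (simp only: skew[OF w uv(2,1)] minus_minus)
    also have "\<dots> = G (N u w) v" by (simp only: sym[OF w uv(1)])
    also have "\<dots> = - G (N u v) w" by (rule skew[OF uv(1) w uv(2)])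
    finally have "G (N u v) w + G (N u v) w = 0" by (simp only: eq_neg_iff_add_eq_0)
    then have "2 *\<^sub>R G (N u v) w = 0" by (simp only: scaleR_2)
    then have "G (N u v) w = 0" by simp
    then show "G (C u v) w = G (C' u v) w"
      using uv w cl by (simp add: N_def metric_app_diff_left)
  qed
  \<comment> \<open>Agreement on sections becomes equality of functions by extensionality, once for
    each argument.\<close>
  then have "C u = C' u" if "u \<in> S" for u
    using that by (intro PiE_ext[OF PiE_mem[OF PiE(1)] PiE_mem[OF PiE(2)]])
  then show ?thesis
    by (rule PiE_ext[OF PiE])
qed

end


text \<open>The first two conjuncts guarantee that the connection in the formula is meaningful: the
  modified bracket is almost-Lie, and the definite description \<open>levi_civita\<close> denotes
  its one Levi-Civita connection.\<close>

theorem proposition3p14: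
  fixes A :: "('m::{t2_space,second_countable_topology}, 'n::real_inner) chart set"
    and E :: "('m, 'f::real_vector) vbundle"
    and \<rho> :: "('m, 'f) anchor"
    and br :: "('m, 'f) secop"
    and L :: "('m, 'f) locop"
    and g :: "'m \<Rightarrow> 'f \<Rightarrow> 'f \<Rightarrow> real"
    and D :: "('m, 'f) secop"
  assumes "smooth_atlas A"
    and "vector_bundle A E"
    and "local_almost_leibniz_algebroid A E \<rho> br L"
    and "E_metric A E g"
    and "E_connection A E \<rho> D"
    and "admissible A E br L D"
  defines "br' \<equiv> modified_bracket A E br L D"
  defines "D' \<equiv> levi_civita A E \<rho> br' g"
    and "T \<equiv> E_torsion A E br L D"
    and "Q \<equiv> E_nonmetricity \<rho> D g"
    and "G \<equiv> metric_app g"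
  shows "almost_lie_algebroid A E \<rho> br' \<and>
    (\<exists>!C. is_levi_civita A E \<rho> br' g C) \<and>
    (\<forall>u\<in>sections A E. \<forall>v\<in>sections A E. \<forall>w\<in>sections A E.
      2 *\<^sub>R G (D u v) w =
        2 *\<^sub>R G (D' u v) w - Q u v w - Q v u w + Q w u v
        - G (T v w) u - G (T u w) v + G (T u v) w)"
proof -
  interpret alg: local_algebroid A E \<rho> D br L
    using assms(1-3,5) by unfold_locales
      (simp_all add: local_almost_leibniz_algebroid_def almost_leibniz_algebroid_def)
  have lie: "almost_lie_algebroid A E \<rho> br'"
    unfolding br'_def by (rule alg.modified_bracket_almost_lie[OF assms(6)])
  interpret mc: metric_connection A E \<rho> D g br'
    using assms(4) lie by unfold_locales
  obtain C where C: "is_levi_civita A E \<rho> br' g C"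
    and koszul: "\<forall>u\<in>sections A E. \<forall>v\<in>sections A E. \<forall>w\<in>sections A E.
      2 *\<^sub>R G (C u v) w = 2 *\<^sub>R G (D u v) w + mc.contorsion_form u v w"
    unfolding G_def by (rule mc.levi_civita_exists)
  have ex1: "\<exists>!C. is_levi_civita A E \<rho> br' g C"
    using C mc.levi_civita_unique by (intro ex1I[of _ C]) auto
  \<comment> \<open>Uniqueness identifies the definite description with the constructed connection,
    for which the formula holds by construction.\<close>
  have "D' = C"
    unfolding D'_def levi_civita_def by (rule the_equality, rule C, erule mc.levi_civita_unique, rule C)
  moreover have "T u v = mc.torsion u v" for u v
    unfolding T_def E_torsion_def mc.torsion_def unfolding br'_def by (rule refl)
  ultimately show ?thesis
    using lie ex1 koszul by (simp add: mc.contorsion_form_def Q_def G_def)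
qed

end
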